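(* For the multitype Galton--Watson tree $H$ with root $\rho$, root age $a(\rho)$ and root degree $\deg(\rho)$, $$\mathbb{E}\left(z^{|H|}s^{\deg(\rho)}\,\middle|\,a(\rho)=x\right)=\frac{z}{\left(1+\tanh(x/2)\sqrt{1-z}\right)^{2s}}\cdot\left(\frac{2}{1+e^{-x}}\right)^{2(s-1)}.$$
   Context: $H$ is the multitype Galton--Watson tree with type space $[0,\infty)$ (types are called ages) defined as follows. The root $\rho$ has random age $a(\rho)$ with law $\pi(dx)=\tfrac12\operatorname{sech}^2(x/2)\,dx$ on $[0,\infty)$. Independently for each vertex, the multiset of ages of the children of a vertex of age $s$ is a Poisson random measure on $[0,\infty)$ with intensity $\lambda_s(dx)=(x\wedge s)\,\pi(dx)$. $|H|$ is the number of vertices of $H$; $\deg(\rho)$ is the number of children of the root. In the identity, $x\ge 0$ and $z,s$ are generating function variables (with $|z|<1$); powers are taken with principal branches. *)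

theory Defs
  imports "HOL-Probability.Probability"
begin

text \<open>
  Ulam--Harris encoding: \<open>t v = Some a\<close> means that \<open>v\<close> is a vertex of \<open>t\<close> of age \<open>a\<close>.
  The root is \<open>[]\<close> and the children of \<open>v\<close> are the vertices of the form \<open>v @ [i]\<close>.
\<close>

type_synonym aged_tree = "nat list \<Rightarrow> real option"

definition is_aged_tree :: "aged_tree \<Rightarrow> bool" where
  "is_aged_tree t \<longleftrightarrow>
     [] \<in> dom t \<and>
     (\<forall>v i. v @ [i] \<in> dom t \<longrightarrow> v \<in> dom t) \<and>
     (\<forall>v\<in>dom t. \<exists>k. \<forall>i. v @ [i] \<in> dom t \<longleftrightarrow> i < k) \<and>
     ran t \<subseteq> {0..}"

definition root_age :: "aged_tree \<Rightarrow> real" where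
  "root_age t = the (t [])"

definition children :: "aged_tree \<Rightarrow> nat list \<Rightarrow> nat list set" where
  "children t v = {w \<in> dom t. \<exists>i. w = v @ [i]}"

definition root_degree :: "aged_tree \<Rightarrow> nat" where
  "root_degree t = card (children t [])"

definition children_ages :: "aged_tree \<Rightarrow> nat list \<Rightarrow> real multiset" where
  "children_ages t v = image_mset (\<lambda>w. the (t w)) (mset_set (children t v))"

text \<open>
  \<open>z\<close> to the power of the number of vertices, for \<open>|z| < 1\<close>. An infinite tree contributes
  \<open>0\<close>; note that \<open>card\<close> of an infinite set is \<open>0\<close>, so \<open>z ^ card (dom t)\<close> would give \<open>1\<close>.
\<close>

definition power_size :: "complex \<Rightarrow> aged_tree \<Rightarrow> complex" where
  "power_size z t = (if finite (dom t) then z ^ card (dom t) else 0)"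

text \<open>The sigma-algebra generated by the part of the tree on the label set \<open>L\<close>.\<close>

definition tree_algebra :: "nat list set \<Rightarrow> aged_tree measure" where
  "tree_algebra L =
     sigma UNIV {{t. v \<in> dom t \<and> the (t v) \<in> B} | v B. v \<in> L \<and> B \<in> sets borel}"

text \<open>
  The Poisson probabilities are written out because the rate may be \<open>0\<close>, where they are
  those of the point mass at \<open>0\<close>; \<^const>\<open>poisson_pmf\<close> is specified for positive rates only.
\<close>

definition poisson_prob :: "real \<Rightarrow> nat \<Rightarrow> real" where
  "poisson_prob r k = exp (- r) * r ^ k / fact k"

text \<open>
  Given \<open>F\<close>, the random multisets \<open>X i\<close>, \<open>i \<in> I\<close>, are independent Poisson random measures with
  the (\<open>F\<close>-measurable, finite) intensities \<open>\<Lambda> i\<close>: conditionally on \<open>F\<close>, the numbers of points of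
  \<open>X i\<close> in pairwise disjoint Borel sets are independent Poisson variables whose rates are the
  intensities of these sets, and the different \<open>X i\<close> are independent.
\<close>

definition cond_indep_poisson_measures ::
  "'w measure \<Rightarrow> 'w measure \<Rightarrow> 'i set \<Rightarrow> ('i \<Rightarrow> 'w \<Rightarrow> real multiset) \<Rightarrow>
     ('i \<Rightarrow> 'w \<Rightarrow> real measure) \<Rightarrow> bool" where
  "cond_indep_poisson_measures M F I X \<Lambda> \<longleftrightarrow>
     (\<forall>J m (B :: 'i \<Rightarrow> nat \<Rightarrow> real set) (k :: 'i \<Rightarrow> nat \<Rightarrow> nat).
        finite J \<longrightarrow> J \<subseteq> I \<longrightarrow>
        (\<forall>i\<in>J. (\<forall>j<m. B i j \<in> sets borel) \<and> disjoint_family_on (B i) {..<m}) \<longrightarrow>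
        (AE \<omega> in M.
           real_cond_exp M F
             (indicator {\<omega> \<in> space M. \<forall>i\<in>J. \<forall>j<m. size {#x \<in># X i \<omega>. x \<in> B i j#} = k i j}) \<omega> =
           (\<Prod>i\<in>J. \<Prod>j<m. poisson_prob (measure (\<Lambda> i \<omega>) (B i j)) (k i j))))"

text \<open>
  \<open>H\<close> is a multitype Galton--Watson tree on the probability space \<open>M\<close>: the age of the root has
  law \<open>\<mu>\<close>, and, given the generations up to \<open>n\<close>, the ages of the children of the vertices \<open>v\<close> in
  generation \<open>n\<close> form independent Poisson random measures with intensities \<open>\<Lambda>\<close> (age of \<open>v\<close>).
  A label that is not a vertex has no children, that is, intensity \<open>0\<close>.
\<close>

definition multitype_GW_tree ::
  "'w measure \<Rightarrow> real measure \<Rightarrow> (real \<Rightarrow> real measure) \<Rightarrow> ('w \<Rightarrow> aged_tree) \<Rightarrow> bool" where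
  "multitype_GW_tree M \<mu> \<Lambda> H \<longleftrightarrow>
     prob_space M \<and>
     H \<in> measurable M (tree_algebra UNIV) \<and>
     (\<forall>\<omega>\<in>space M. is_aged_tree (H \<omega>)) \<and>
     distr M borel (\<lambda>\<omega>. root_age (H \<omega>)) = \<mu> \<and>
     (\<forall>n. cond_indep_poisson_measures M
            (vimage_algebra (space M) H (tree_algebra {v. length v \<le> n}))
            {v. length v = n}
            (\<lambda>v \<omega>. children_ages (H \<omega>) v)
            (\<lambda>v \<omega>. case H \<omega> v of None \<Rightarrow> null_measure borel | Some a \<Rightarrow> \<Lambda> a))"

definition sech :: "real \<Rightarrow> real" where
  "sech x = 1 / cosh x"

definition age_law :: "real measure" where
  "age_law = density lborel (\<lambda>x. ennreal (indicator {0..} x * (1/2 * (sech (x / 2))\<^sup>2)))"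

definition offspring_intensity :: "real \<Rightarrow> real measure" where
  "offspring_intensity s = density age_law (\<lambda>x. ennreal (min x s))"

definition complex_cond_exp :: "'w measure \<Rightarrow> 'w measure \<Rightarrow> ('w \<Rightarrow> complex) \<Rightarrow> 'w \<Rightarrow> complex" where
  "complex_cond_exp M F f \<omega> =
     Complex (real_cond_exp M F (\<lambda>\<omega>. Re (f \<omega>)) \<omega>) (real_cond_exp M F (\<lambda>\<omega>. Im (f \<omega>)) \<omega>)"

end

theory Submission
  imports Defs
begin

text \<open>
  Let \<open>t = tanh (x / 2)\<close> and \<open>c = \<surd>(1 - z)\<close>; then \<open>t\<close> is the distribution function of \<open>\<pi>\<close>. By the
  branching property, \<open>F(x) = E(z ^ |H| | a(\<rho>) = x)\<close> solves
  \<open>F(x) = z exp (\<integral> (F(y) - 1) min(x,y) \<pi>(dy))\<close>, and the function in question is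
  \<open>z exp (\<integral> (s F(y) - 1) min(x,y) \<pi>(dy))\<close>, since \<open>s\<close> only weights the children of the root. Both
  integrals are explicit: \<open>min(x,y)\<close> is the Green function of minus the second derivative, so
  \<open>\<integral> f(y) min(x,y) \<pi>(dy) = h(x) - h(0)\<close> as soon as \<open>h'' = - f \<pi>\<close> and \<open>h'\<close> vanishes at infinity
  (\<open>integral_offspring_intensity\<close>). For \<open>f = 1\<close> this gives \<open>h = 2 ln (1 + t)\<close>, and for
  \<open>f = z / (1 + c t)\<^sup>2\<close> it gives \<open>h = 2 Ln (1 + t) - 2 Ln (1 + c t)\<close> (\<open>integral_progeny_pgf\<close>). Hence
  \<open>z / (1 + c t)\<^sup>2\<close> solves the equation for \<open>F\<close>, and the claim follows from
  \<open>2 / (1 + e\<^sup>-\<^sup>x) = 1 + t\<close>.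

  Two points need care. The first is the branching property. A Galton--Watson tree is specified by
  the conditional probabilities of the numbers of children with ages in finitely many sets, given
  the preceding generations. Summing over these numbers, for step functions and then in the limit,
  yields the generating functional of one generation given the past
  (\<open>generation_generating_functional\<close>). Applied to the generations \<open>n, n - 1, \<dots>, 1\<close> in turn, it
  expresses the contribution of the trees of height at most \<open>n\<close> through the \<open>n\<close>-th iterate, from
  \<open>0\<close>, of the map whose fixed point is \<open>F\<close> (\<open>height_generating_function\<close>). Then \<open>n\<close> tends to
  infinity, with \<open>|s| ^ deg(\<rho>)\<close> as the dominating function: the degree of the root has tails of
  Poisson type.

  The second point is that these iterates converge to the closed form. In the supremum norm the map
  need not contract, as the total mass of \<open>min(x,y) \<pi>(dy)\<close> may exceed \<open>1\<close>. However, \<open>tanh (x / 2)\<close> is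
  an eigenfunction of the kernel \<open>min(x,y) \<pi>(dy)\<close> with eigenvalue \<open>1\<close> (the tree is critical), so
  distances measured relative to \<open>tanh (x / 2)\<close> contract by the factor \<open>|z|\<close>
  (\<open>height_pgf_tendsto_progeny_pgf\<close>).
\<close>

section \<open>Generations of an aged tree\<close>

definition generation :: "aged_tree \<Rightarrow> nat \<Rightarrow> nat list set" where
  "generation t n = {v \<in> dom t. length v = n}"

definition generation_prod :: "(real \<Rightarrow> complex) \<Rightarrow> nat \<Rightarrow> aged_tree \<Rightarrow> complex" where
  "generation_prod f n t = (\<Prod>v\<in>generation t n. f (the (t v)))"

definition offspring_prod :: "(real \<Rightarrow> complex) \<Rightarrow> aged_tree \<Rightarrow> nat list \<Rightarrow> complex" where
  "offspring_prod f t v = (\<Prod>x\<in>#children_ages t v. f x)"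

text \<open>
  Finite sets of labels that exhaust the \<open>n\<close>-th level of the Ulam--Harris tree as \<open>K\<close> grows. They turn
  products over the random set of vertices of a generation into limits of products over fixed
  sets.
\<close>

definition labels :: "nat \<Rightarrow> nat \<Rightarrow> nat list set" where
  "labels n K = {v. set v \<subseteq> {..<K} \<and> length v = n}"

lemma finite_labels [simp]: "finite (labels n K)"
  unfolding labels_def by (rule finite_lists_length_eq) simp

lemma is_aged_tree_root: "is_aged_tree t \<Longrightarrow> [] \<in> dom t"
  by (simp add: is_aged_tree_def)

lemma is_aged_tree_age_nonneg:
  assumes "is_aged_tree t" "t v = Some a" shows "0 \<le> a"
proof -
  have "a \<in> ran t" using assms(2) by (auto simp: ran_def)
  then show ?thesis using assms(1) unfolding is_aged_tree_def by auto
qed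

lemma children_outside:
  assumes "is_aged_tree t" "v \<notin> dom t" shows "children t v = {}"
  using assms unfolding is_aged_tree_def children_def by blast

lemma finite_children:
  assumes t: "is_aged_tree t" shows "finite (children t v)"
proof (cases "v \<in> dom t")
  case True
  then obtain k where k: "\<And>i. v @ [i] \<in> dom t \<longleftrightarrow> i < k"
    using t unfolding is_aged_tree_def by meson
  have "children t v \<subseteq> (\<lambda>i. v @ [i]) ` {..<k}"
    using k by (auto simp: children_def)
  then show ?thesis by (rule finite_subset) simp
qed (simp add: children_outside t)

lemma generation_0: "is_aged_tree t \<Longrightarrow> generation t 0 = {[]}"
  using is_aged_tree_root by (auto simp: generation_def)

lemma generation_Suc:
  assumes t: "is_aged_tree t"
  shows "generation t (Suc n) = (\<Union>v\<in>generation t n. children t v)"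
proof -
  have "\<exists>v. (v \<in> dom t \<and> length v = n) \<and> (\<exists>i. w = v @ [i])"
    if "w \<in> dom t" "length w = Suc n" for w
  proof -
    obtain v i where w: "w = v @ [i]"
      using \<open>length w = Suc n\<close> by (metis length_Suc_conv_rev)
    moreover have "v \<in> dom t" using t that(1) w unfolding is_aged_tree_def by blast
    ultimately show ?thesis using that(2) by auto
  qed
  then show ?thesis by (fastforce simp: generation_def children_def)
qed

lemma finite_generation: "is_aged_tree t \<Longrightarrow> finite (generation t n)"
  by (induction n) (auto simp: generation_0 generation_Suc finite_children)

lemma offspring_prod_children:
  "offspring_prod f t v = (\<Prod>w\<in>children t v. f (the (t w)))"
  by (simp add: prod_unfold_prod_mset offspring_prod_def children_ages_def
      image_mset.compositionality o_def)

lemma generation_prod_Suc: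
  assumes t: "is_aged_tree t"
  shows "generation_prod f (Suc n) t = (\<Prod>v\<in>generation t n. offspring_prod f t v)"
proof -
  have "generation_prod f (Suc n) t =
        (\<Prod>v\<in>generation t n. \<Prod>w\<in>children t v. f (the (t w)))"
    unfolding generation_prod_def generation_Suc[OF t]
    by (rule prod.UNION_disjoint) (simp_all add: finite_generation finite_children t, auto simp: children_def)
  also have "\<dots> = (\<Prod>v\<in>generation t n. offspring_prod f t v)"
    by (simp add: offspring_prod_children)
  finally show ?thesis .
qed

lemma generation_prod_mult:
  "generation_prod (\<lambda>x. f x * g x) n t = generation_prod f n t * generation_prod g n t"
  by (simp add: generation_prod_def prod.distrib)

lemma generation_prod_const: "generation_prod (\<lambda>_. c) n t = c ^ card (generation t n)"
  by (simp add: generation_prod_def)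

lemma norm_generation_prod_le_1:
  assumes "\<And>x. norm (f x) \<le> 1" shows "norm (generation_prod f n t) \<le> 1"
  unfolding generation_prod_def prod_norm[symmetric] using assms by (intro prod_le_1) auto

lemma root_degree_eq:
  assumes t: "is_aged_tree t" shows "root_degree t = card (generation t 1)"
  using generation_Suc[OF t, of 0] by (simp add: root_degree_def generation_0[OF t])

lemma eventually_generation_subset_labels:
  assumes t: "is_aged_tree t"
  shows "eventually (\<lambda>K. generation t n \<subseteq> labels n K) sequentially"
proof -
  have "finite (\<Union>v\<in>generation t n. set v)" by (simp add: finite_generation[OF t])
  then obtain K0 where K0: "(\<Union>v\<in>generation t n. set v) \<subseteq> {..<K0}"
    by (meson finite_nat_iff_bounded)
  have "generation t n \<subseteq> labels n K" if "K \<ge> K0" for K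
    using K0 that by (fastforce simp: labels_def generation_def)
  then show ?thesis by (auto simp: eventually_sequentially)
qed

text \<open>
  A generation is finite, so the sequence is eventually constant.
\<close>

lemma tendsto_prod_labels:
  fixes g :: "nat list \<Rightarrow> complex"
  assumes t: "is_aged_tree t" and g: "\<And>v. v \<notin> dom t \<Longrightarrow> g v = 1"
  shows "(\<lambda>K. \<Prod>v\<in>labels n K. g v) \<longlonglongrightarrow> (\<Prod>v\<in>generation t n. g v)"
proof (rule tendsto_eventually)
  show "eventually (\<lambda>K. (\<Prod>v\<in>labels n K. g v) = (\<Prod>v\<in>generation t n. g v)) sequentially"
    using eventually_generation_subset_labels[OF t]
  proof (rule eventually_mono)
    fix K assume "generation t n \<subseteq> labels n K"
    then show "(\<Prod>v\<in>labels n K. g v) = (\<Prod>v\<in>generation t n. g v)"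
      by (intro prod.mono_neutral_right finite_labels ballI g) (auto simp: generation_def labels_def)
  qed
qed

text \<open>
  The factor \<open>generation_prod (\<lambda>_. 0) (Suc n) t\<close> is the indicator of the event that generation
  \<open>n + 1\<close> is empty. For a finite tree it is eventually \<open>1\<close>. In an infinite tree no generation is
  empty, because all generations are finite; the limit is then \<open>0\<close>, in accordance with
  \<^const>\<open>power_size\<close>.
\<close>

lemma power_size_tendsto:
  assumes t: "is_aged_tree t"
  shows "(\<lambda>n. (\<Prod>i\<le>n. z ^ card (generation t i)) * generation_prod (\<lambda>_. 0) (Suc n) t)
            \<longlonglongrightarrow> power_size z t"
proof (rule tendsto_eventually)
  have dom: "dom t = (\<Union>n. generation t n)" by (auto simp: generation_def)
  have card_eq: "generation_prod (\<lambda>_. 0) (Suc n) t = (if generation t (Suc n) = {} then 1 else 0)" for n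
    using finite_generation[OF t] by (simp add: generation_prod_const card_gt_0_iff)
  have empty_mono: "generation t m = {}" if "generation t n = {}" "n \<le> m" for n m
    using that(2,1) by (induction rule: dec_induct) (simp_all add: generation_Suc[OF t])
  have dom_finite: "dom t = (\<Union>i\<le>n. generation t i)" if "generation t (Suc n) = {}" for n
  proof -
    have "generation t i = {}" if "\<not> i \<le> n" for i
      using empty_mono[OF \<open>generation t (Suc n) = {}\<close>, of i] that by simp
    then show ?thesis unfolding dom by blast
  qed
  show "eventually (\<lambda>n. (\<Prod>i\<le>n. z ^ card (generation t i)) * generation_prod (\<lambda>_. 0) (Suc n) t
            = power_size z t) sequentially"
  proof (cases "finite (dom t)")
    case False
    have "generation t (Suc n) \<noteq> {}" for n
      using dom_finite[of n] False finite_generation[OF t] by auto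
    then show ?thesis using False by (simp add: card_eq power_size_def)
  next
    case True
    then have "finite (length ` dom t)" by simp
    then obtain N where N: "length ` dom t \<subseteq> {..<N}"
      by (meson finite_nat_iff_bounded)
    have "(\<Prod>i\<le>n. z ^ card (generation t i)) * generation_prod (\<lambda>_. 0) (Suc n) t = power_size z t"
      if "n \<ge> N" for n
    proof -
      have e: "generation t (Suc n) = {}" using N that by (fastforce simp: generation_def)
      have "card (dom t) = (\<Sum>i\<le>n. card (generation t i))"
        unfolding dom_finite[OF e]
        by (rule card_UN_disjoint) (auto simp: finite_generation[OF t], auto simp: generation_def)
      then show ?thesis using True e
        by (simp add: card_eq power_size_def power_sum)
    qed
    then show ?thesis by (auto simp: eventually_sequentially)
  qed
qed

section \<open>Measurability with respect to the first generations\<close>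

definition upto_generation :: "'w measure \<Rightarrow> ('w \<Rightarrow> aged_tree) \<Rightarrow> nat \<Rightarrow> 'w measure" where
  "upto_generation M H n = vimage_algebra (space M) H (tree_algebra {v. length v \<le> n})"

lemma space_tree_algebra [simp]: "space (tree_algebra L) = UNIV"
  by (simp add: tree_algebra_def space_measure_of_conv)

lemma sets_tree_algebra:
  "sets (tree_algebra L) =
     sigma_sets UNIV {{t. v \<in> dom t \<and> the (t v) \<in> B} | v B. v \<in> L \<and> B \<in> sets borel}"
  unfolding tree_algebra_def by (rule sets_measure_of) auto

lemma vertex_set_measurable:
  assumes "v \<in> L" "B \<in> sets borel"
  shows "{t. v \<in> dom t \<and> the (t v) \<in> B} \<in> sets (tree_algebra L)"
  unfolding sets_tree_algebra using assms by (intro sigma_sets.Basic) auto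

lemma sets_tree_algebra_mono:
  assumes "L \<subseteq> L'" shows "sets (tree_algebra L) \<subseteq> sets (tree_algebra L')"
  unfolding sets_tree_algebra using assms by (intro sigma_sets_mono') blast

lemma measurable_vertex_age:
  fixes f :: "real \<Rightarrow> 'b::topological_space"
  assumes v: "v \<in> L" and f: "f \<in> borel_measurable borel"
  shows "(\<lambda>t. case t v of None \<Rightarrow> d | Some a \<Rightarrow> f a) \<in> borel_measurable (tree_algebra L)"
proof (rule measurableI)
  fix S :: "'b set" assume S: "S \<in> sets borel"
  have B: "f -` S \<in> sets borel" using measurable_sets[OF f S] by simp
  have "{t. v \<in> dom t \<and> the (t v) \<in> (UNIV::real set)} \<in> sets (tree_algebra L)"
    using v by (intro vertex_set_measurable) auto
  from sets.compl_sets[OF this]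
  have N: "{t::aged_tree. v \<notin> dom t} \<in> sets (tree_algebra L)"
    by (simp add: Collect_neg_eq Compl_eq_Diff_UNIV)
  have D: "(if d \<in> S then {t::aged_tree. v \<notin> dom t} else {}) \<in> sets (tree_algebra L)"
    using N by simp
  have "(\<lambda>t. case t v of None \<Rightarrow> d | Some a \<Rightarrow> f a) -` S \<inter> space (tree_algebra L) =
      {t. v \<in> dom t \<and> the (t v) \<in> f -` S} \<union> (if d \<in> S then {t. v \<notin> dom t} else {})"
    by (auto split: option.splits)
  also have "\<dots> \<in> sets (tree_algebra L)"
    by (rule sets.Un[OF vertex_set_measurable[OF v B] D])
  finally show "(\<lambda>t. case t v of None \<Rightarrow> d | Some a \<Rightarrow> f a) -` S \<inter> space (tree_algebra L)
      \<in> sets (tree_algebra L)" .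
qed simp

lemma measurable_upto_vertex_age:
  fixes f :: "real \<Rightarrow> 'b::topological_space"
  assumes "length v \<le> n" "f \<in> borel_measurable borel"
  shows "(\<lambda>\<omega>. case H \<omega> v of None \<Rightarrow> d | Some a \<Rightarrow> f a) \<in> borel_measurable (upto_generation M H n)"
proof -
  have "H \<in> measurable (upto_generation M H n) (tree_algebra {v. length v \<le> n})"
    unfolding upto_generation_def by (rule measurable_vimage_algebra1) simp
  from measurable_compose[OF this measurable_vertex_age[of v _ f d]] assms show ?thesis by simp
qed

lemma space_upto_generation [simp]: "space (upto_generation M H n) = space M"
  by (simp add: upto_generation_def)

lemma measurable_upto_generation_prod:
  assumes t: "\<And>\<omega>. \<omega> \<in> space M \<Longrightarrow> is_aged_tree (H \<omega>)"
    and "i \<le> n" and f: "f \<in> borel_measurable borel"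
  shows "(\<lambda>\<omega>. generation_prod f i (H \<omega>)) \<in> borel_measurable (upto_generation M H n)"
proof (rule borel_measurable_LIMSEQ_metric)
  let ?g = "\<lambda>v \<omega>. case H \<omega> v of None \<Rightarrow> 1 | Some a \<Rightarrow> f a"
  show "(\<lambda>\<omega>. \<Prod>v\<in>labels i K. ?g v \<omega>) \<in> borel_measurable (upto_generation M H n)" for K
    using \<open>i \<le> n\<close> f
    by (intro borel_measurable_prod measurable_upto_vertex_age) (auto simp: labels_def)
  fix \<omega> assume "\<omega> \<in> space (upto_generation M H n)"
  then have "is_aged_tree (H \<omega>)" using t by simp
  then have "(\<lambda>K. \<Prod>v\<in>labels i K. ?g v \<omega>) \<longlonglongrightarrow> (\<Prod>v\<in>generation (H \<omega>) i. ?g v \<omega>)"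
    by (rule tendsto_prod_labels) (auto split: option.splits)
  also have "(\<Prod>v\<in>generation (H \<omega>) i. ?g v \<omega>) = generation_prod f i (H \<omega>)"
    unfolding generation_prod_def by (rule prod.cong) (auto simp: generation_def)
  finally show "(\<lambda>K. \<Prod>v\<in>labels i K. ?g v \<omega>) \<longlonglongrightarrow> generation_prod f i (H \<omega>)" .
qed

lemma subalgebra_upto_generation:
  assumes H: "H \<in> measurable M (tree_algebra UNIV)"
  shows "subalgebra M (upto_generation M H n)"
proof -
  have "H -` A \<inter> space M \<in> sets M" if "A \<in> sets (tree_algebra {v. length v \<le> n})" for A
    using measurable_sets[OF H] sets_tree_algebra_mono[of _ UNIV] that by blast
  then show ?thesis
    unfolding subalgebra_def upto_generation_def by (auto simp: sets_vimage_algebra2)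
qed

lemma measurable_offspring_count:
  assumes t: "\<And>\<omega>. \<omega> \<in> space M \<Longrightarrow> is_aged_tree (H \<omega>)"
    and H: "H \<in> measurable M (tree_algebra UNIV)" and B: "B \<in> sets borel"
  shows "(\<lambda>\<omega>. size {#x \<in># children_ages (H \<omega>) v. x \<in> B#}) \<in> measurable M (count_space UNIV)"
proof -
  let ?g = "\<lambda>i t. case t (v @ [i]) of None \<Rightarrow> 0 | Some a \<Rightarrow> (indicator B a :: real)"
  let ?N = "\<lambda>\<omega>. size {#x \<in># children_ages (H \<omega>) v. x \<in> B#}"
  have "(\<lambda>\<omega>. real (?N \<omega>)) \<in> borel_measurable M"
  proof (rule borel_measurable_LIMSEQ_metric)
    show "(\<lambda>\<omega>. \<Sum>i<K. ?g i (H \<omega>)) \<in> borel_measurable M" for K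
      using B by (intro borel_measurable_sum measurable_compose[OF H] measurable_vertex_age) auto
    fix \<omega> assume "\<omega> \<in> space M"
    then have T: "is_aged_tree (H \<omega>)" by (rule t)
    let ?I = "{i. v @ [i] \<in> dom (H \<omega>)}"
    have ch: "children (H \<omega>) v = (\<lambda>i. v @ [i]) ` ?I" by (auto simp: children_def)
    have inj: "inj_on (\<lambda>i. v @ [i]) ?I" by (auto simp: inj_on_def)
    have fin: "finite ?I" using finite_children[OF T, of v] unfolding ch by (simp add: finite_image_iff inj)
    have "real (?N \<omega>) = real (card {w \<in> children (H \<omega>) v. the (H \<omega> w) \<in> B})"
      using finite_children[OF T, of v]
      by (simp add: children_ages_def filter_mset_image_mset filter_mset_mset_set)
    also have "\<dots> = (\<Sum>w\<in>children (H \<omega>) v. indicator B (the (H \<omega> w)))"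
      using finite_children[OF T, of v] by (simp add: indicator_def sum.If_cases Int_def)
    also have "\<dots> = (\<Sum>i\<in>?I. ?g i (H \<omega>))"
      unfolding ch sum.reindex[OF inj] by (rule sum.cong) auto
    finally have N: "real (?N \<omega>) = (\<Sum>i\<in>?I. ?g i (H \<omega>))" .
    obtain K0 where K0: "?I \<subseteq> {..<K0}" using fin by (meson finite_nat_iff_bounded)
    have "(\<Sum>i<K. ?g i (H \<omega>)) = real (?N \<omega>)" if "K \<ge> K0" for K
      unfolding N using K0 that by (intro sum.mono_neutral_right) (auto split: option.splits)
    then show "(\<lambda>K. \<Sum>i<K. ?g i (H \<omega>)) \<longlonglongrightarrow> real (?N \<omega>)"
      by (intro tendsto_eventually) (auto simp: eventually_sequentially)
  qed
  then have "?N -` {k} \<inter> space M \<in> sets M" for k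
  proof -
    assume m: "(\<lambda>\<omega>. real (?N \<omega>)) \<in> borel_measurable M"
    have "?N -` {k} \<inter> space M = (\<lambda>\<omega>. real (?N \<omega>)) -` {real k} \<inter> space M" by auto
    then show ?thesis using measurable_sets[OF m, of "{real k}"] by simp
  qed
  then show ?thesis by (subst measurable_count_space_eq2_countable) auto
qed

section \<open>Step functions\<close>

text \<open>
  A step function together with an explicit finite partition, the form in which the Poisson
  property of the offspring can be applied.
\<close>

definition step_function ::
  "(real \<Rightarrow> complex) \<Rightarrow> nat \<Rightarrow> (nat \<Rightarrow> complex) \<Rightarrow> (nat \<Rightarrow> real set) \<Rightarrow> bool" where
  "step_function f m c B \<longleftrightarrow>
     (\<forall>j<m. B j \<in> sets borel \<and> c j \<in> range f \<and> (\<forall>x\<in>B j. f x = c j)) \<and>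
     disjoint_family_on B {..<m} \<and> (\<Union>j<m. B j) = UNIV"

lemma disjoint_family_on_unique:
  assumes "disjoint_family_on B I" "i \<in> I" "j \<in> I" "x \<in> B i"
  shows "x \<in> B j \<longleftrightarrow> j = i"
  using disjoint_family_onD[OF assms(1-3)] assms(4) by blast

lemma simple_function_imp_step_function:
  assumes f: "simple_function borel f"
  obtains m c B where "step_function f m c B"
proof -
  have fin: "finite (range f)" using simple_functionD(1)[OF f] by simp
  obtain c where c: "bij_betw c {0..<card (range f)} (range f)"
    using ex_bij_betw_nat_finite[OF fin] by blast
  have cr: "c ` {..<card (range f)} = range f"
    using c by (simp add: bij_betw_def lessThan_atLeast0)
  have inj: "inj_on c {..<card (range f)}"
    using c by (simp add: bij_betw_def lessThan_atLeast0)
  let ?B = "\<lambda>j. f -` {c j}"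
  have "?B j \<in> sets borel" for j using simple_functionD(2)[OF f, of "{c j}"] by simp
  moreover have "disjoint_family_on ?B {..<card (range f)}"
    using inj by (auto simp: disjoint_family_on_def inj_on_def)
  moreover have "\<exists>j<card (range f). f x = c j" for x
    using cr by (metis imageE lessThan_iff rangeI)
  ultimately have "step_function f (card (range f)) c ?B"
    using cr unfolding step_function_def by (auto simp: Bex_def)
  then show thesis by (rule that)
qed

text \<open>
  Points of \<open>A\<close> in the same cell contribute the same factor, so a product over a multiset depends
  on the cell counts only.
\<close>

lemma step_function_prod_mset:
  fixes d :: "nat \<Rightarrow> 'b::comm_monoid_mult"
  assumes B: "disjoint_family_on B {..<m}" "(\<Union>j<m. B j) = (UNIV::real set)"
    and g: "\<And>j x. j < m \<Longrightarrow> x \<in> B j \<Longrightarrow> g x = d j"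
  shows "(\<Prod>x\<in>#A. g x) = (\<Prod>j<m. d j ^ size {#x \<in># A. x \<in> B j#})"
proof (induction A)
  case (add x A)
  obtain i where i: "i < m" "x \<in> B i" using B(2) by blast
  have "x \<in> B j \<longleftrightarrow> j = i" if "j < m" for j
    using i that by (intro disjoint_family_on_unique[OF B(1)]) auto
  then have "(\<Prod>j<m. d j ^ size {#y \<in># add_mset x A. y \<in> B j#}) =
        (\<Prod>j<m. (if j = i then d j else 1) * d j ^ size {#y \<in># A. y \<in> B j#})"
    by (intro prod.cong) auto
  also have "\<dots> = d i * (\<Prod>j<m. d j ^ size {#y \<in># A. y \<in> B j#})"
    using i(1) by (simp add: prod.distrib prod.delta)
  finally show ?case using add g[OF i] by simp
qed simp

lemma step_function_integral:
  assumes f: "step_function f m c B" and fin: "finite_measure \<nu>" and \<nu>: "sets \<nu> = sets borel"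
  shows "(\<integral>x. (f x - 1) \<partial>\<nu>) = (\<Sum>j<m. of_real (measure \<nu> (B j)) * (c j - 1))"
proof -
  interpret finite_measure \<nu> by (rule fin)
  have B: "B j \<in> sets \<nu>" if "j < m" for j
    using f that \<nu> by (simp add: step_function_def)
  have "f x - 1 = (\<Sum>j<m. indicator (B j) x *\<^sub>R (c j - 1))" for x
  proof -
    obtain i where i: "i < m" "x \<in> B i" using f unfolding step_function_def by blast
    have "x \<in> B j \<longleftrightarrow> j = i" if "j < m" for j
      using f i that by (intro disjoint_family_on_unique[of B "{..<m}"]) (auto simp: step_function_def)
    then have "(\<Sum>j<m. indicator (B j) x *\<^sub>R (c j - 1)) = (\<Sum>j<m. if j = i then c j - 1 else 0)"
      by (intro sum.cong) auto
    then show ?thesis using f i by (simp add: step_function_def)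
  qed
  then have "(\<integral>x. (f x - 1) \<partial>\<nu>) = (\<integral>x. (\<Sum>j<m. indicator (B j) x *\<^sub>R (c j - 1)) \<partial>\<nu>)" by simp
  also have "\<dots> = (\<Sum>j<m. \<integral>x. indicator (B j) x *\<^sub>R (c j - 1) \<partial>\<nu>)"
    using B by (intro Bochner_Integration.integral_sum integrable_scaleR_left)
      (auto simp: less_top[symmetric])
  also have "\<dots> = (\<Sum>j<m. of_real (measure \<nu> (B j)) * (c j - 1))"
  proof (rule sum.cong)
    fix j assume "j \<in> {..<m}"
    then have "B j \<in> sets \<nu>" using B by simp
    then have "(\<integral>x. indicator (B j) x *\<^sub>R (c j - 1) \<partial>\<nu>) = measure \<nu> (B j) *\<^sub>R (c j - 1)"
      by (subst integral_scaleR_left) (auto simp: less_top[symmetric] Int_absorb2 sets.sets_into_space)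
    then show "(\<integral>x. indicator (B j) x *\<^sub>R (c j - 1) \<partial>\<nu>) = of_real (measure \<nu> (B j)) * (c j - 1)"
      by (simp add: scaleR_conv_of_real)
  qed simp
  finally show ?thesis .
qed

text \<open>
  Simple functions that converge to \<open>f\<close> may overshoot the bound \<open>R\<close>. Composition with the radial
  retraction onto the disc of radius \<open>R\<close> restores the bound, which the domination arguments below
  rely on for large random products.
\<close>

lemma bounded_measurable_step_approximation:
  fixes f :: "real \<Rightarrow> complex"
  assumes f: "f \<in> borel_measurable borel" and bd: "\<And>x. norm (f x) \<le> R" and R: "0 < R"
  obtains g where "\<And>i. simple_function borel (g i)" "\<And>i x. norm (g i x) \<le> R"
    "\<And>x. (\<lambda>i. g i x) \<longlonglongrightarrow> f x"
proof -
  obtain u where u: "\<And>i. simple_function borel (u i)" "\<And>x. (\<lambda>i. u i x) \<longlonglongrightarrow> f x"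
    using borel_measurable_implies_sequence_metric[OF f, of 0] by auto
  define \<rho> :: "complex \<Rightarrow> complex" where "\<rho> w = (R / max R (norm w)) *\<^sub>R w" for w
  have \<rho>_le: "norm (\<rho> w) \<le> R" for w
    using R by (auto simp: \<rho>_def max_def field_simps)
  have "(\<lambda>i. \<rho> (u i x)) \<longlonglongrightarrow> \<rho> (f x)" for x
    unfolding \<rho>_def using R by (intro tendsto_intros u) auto
  moreover have "\<rho> (f x) = f x" for x using bd[of x] R by (simp add: \<rho>_def max_def)
  moreover have "simple_function borel (\<lambda>x. \<rho> (u i x))" for i
    by (rule simple_function_compose1[OF u(1)])
  ultimately show thesis using \<rho>_le by (intro that[of "\<lambda>i x. \<rho> (u i x)"]) auto
qed

section \<open>Bounded kernels\<close>

locale bounded_kernel =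
  fixes \<Lambda> :: "real \<Rightarrow> real measure" and C :: real
  assumes finite_kernel: "finite_measure (\<Lambda> a)"
    and sets_kernel: "sets (\<Lambda> a) = sets borel"
    and measurable_kernel: "B \<in> sets borel \<Longrightarrow> (\<lambda>a. measure (\<Lambda> a) B) \<in> borel_measurable borel"
    and kernel_le: "measure (\<Lambda> a) UNIV \<le> C"
begin

lemma space_kernel: "space (\<Lambda> a) = UNIV"
  using sets_eq_imp_space_eq[OF sets_kernel] by simp

lemma C_nonneg: "0 \<le> C"
  using kernel_le[of 0] measure_nonneg[of "\<Lambda> 0" UNIV] by linarith

lemma measurable_kernel_iff: "f \<in> borel_measurable (\<Lambda> a) \<longleftrightarrow> f \<in> borel_measurable borel"
  by (rule arg_cong[of _ _ "\<lambda>S. f \<in> S"], rule measurable_cong_sets) (simp_all add: sets_kernel)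

lemma integrable_kernel:
  fixes f :: "real \<Rightarrow> complex"
  assumes "f \<in> borel_measurable borel" "\<And>x. norm (f x) \<le> R"
  shows "integrable (\<Lambda> a) f"
  by (rule finite_measure.integrable_const_bound[OF finite_kernel, where B=R])
    (use assms in \<open>auto simp: measurable_kernel_iff\<close>)

lemma norm_integral_kernel_le:
  fixes f :: "real \<Rightarrow> complex"
  assumes f: "f \<in> borel_measurable borel" "\<And>x. norm (f x) \<le> R"
  shows "norm (\<integral>x. f x \<partial>\<Lambda> a) \<le> R * C"
proof -
  interpret finite_measure "\<Lambda> a" by (rule finite_kernel)
  have "0 \<le> R" using f(2)[of 0] norm_ge_zero[of "f 0"] by linarith
  have "norm (\<integral>x. f x \<partial>\<Lambda> a) \<le> (\<integral>x. norm (f x) \<partial>\<Lambda> a)" by (rule integral_norm_bound)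
  also have "\<dots> \<le> (\<integral>x. R \<partial>\<Lambda> a)"
    using f by (intro integral_mono integrable_norm integrable_kernel) auto
  also have "\<dots> \<le> R * C" using kernel_le[of a] \<open>0 \<le> R\<close>
    by (simp add: space_kernel mult.commute[of _ R] mult_left_mono)
  finally show ?thesis .
qed

lemma tendsto_integral_kernel:
  fixes f :: "nat \<Rightarrow> real \<Rightarrow> complex"
  assumes "\<And>i. f i \<in> borel_measurable borel" "g \<in> borel_measurable borel"
    and "\<And>i x. norm (f i x) \<le> R" "AE x in \<Lambda> a. (\<lambda>i. f i x) \<longlonglongrightarrow> g x"
  shows "(\<lambda>i. \<integral>x. f i x \<partial>\<Lambda> a) \<longlonglongrightarrow> (\<integral>x. g x \<partial>\<Lambda> a)"
proof (rule integral_dominated_convergence[where w="\<lambda>_. R"])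
  interpret finite_measure "\<Lambda> a" by (rule finite_kernel)
  show "integrable (\<Lambda> a) (\<lambda>_. R)" by simp
qed (use assms in \<open>auto simp: measurable_kernel_iff\<close>)

text \<open>The weight \<open>exp (\<integral> (f - 1) d\<Lambda>\<^sub>a)\<close> is the generating functional of a Poisson random
  measure of intensity \<open>\<Lambda>\<^sub>a\<close>.\<close>

definition poisson_functional :: "(real \<Rightarrow> complex) \<Rightarrow> real \<Rightarrow> complex" where
  "poisson_functional f a = exp (\<integral>x. (f x - 1) \<partial>\<Lambda> a)"

lemma tendsto_poisson_functional:
  fixes f :: "nat \<Rightarrow> real \<Rightarrow> complex"
  assumes "\<And>i. f i \<in> borel_measurable borel" "g \<in> borel_measurable borel"
    and bd: "\<And>i x. norm (f i x) \<le> R" and "AE x in \<Lambda> a. (\<lambda>i. f i x) \<longlonglongrightarrow> g x"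
  shows "(\<lambda>i. poisson_functional (f i) a) \<longlonglongrightarrow> poisson_functional g a"
  unfolding poisson_functional_def
proof (intro tendsto_exp tendsto_integral_kernel[where R="R + 1"])
  show "norm (f i x - 1) \<le> R + 1" for i x
    using norm_triangle_ineq4[of "f i x" 1] bd[of i x] by simp
qed (use assms in \<open>auto elim!: eventually_mono intro!: tendsto_intros\<close>)

lemma norm_poisson_functional_le:
  assumes "f \<in> borel_measurable borel" "\<And>x. norm (f x) \<le> R"
  shows "norm (poisson_functional f a) \<le> exp ((R + 1) * C)"
proof -
  have "norm (\<integral>x. (f x - 1) \<partial>\<Lambda> a) \<le> (R + 1) * C"
  proof (rule norm_integral_kernel_le)
    show "norm (f x - 1) \<le> R + 1" for x
      using norm_triangle_ineq4[of "f x" 1] assms(2)[of x] by simp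
  qed (use assms in auto)
  then show ?thesis unfolding poisson_functional_def norm_exp_eq_Re
    using complex_Re_le_cmod[of "\<integral>x. (f x - 1) \<partial>\<Lambda> a"] by simp
qed

text \<open>
  The real part of the exponent is at most \<open>0\<close>. Iterating the functional therefore stays in the unit
  disc.
\<close>

lemma norm_poisson_functional_le_1:
  assumes f: "f \<in> borel_measurable borel" "\<And>x. norm (f x) \<le> 1"
  shows "norm (poisson_functional f a) \<le> 1"
proof -
  have int: "integrable (\<Lambda> a) (\<lambda>x. f x - 1)"
  proof (rule integrable_kernel[where R=2])
    show "norm (f x - 1) \<le> 2" for x
      using norm_triangle_ineq4[of "f x" 1] f(2)[of x] by simp
  qed (use f in auto)
  have "Re (f x) \<le> 1" for x using complex_Re_le_cmod[of "f x"] f(2)[of x] by linarith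
  then have "0 \<le> (\<integral>x. - Re (f x - 1) \<partial>\<Lambda> a)" by (intro Bochner_Integration.integral_nonneg) simp
  then have "(\<integral>x. Re (f x - 1) \<partial>\<Lambda> a) \<le> 0" by (simp only: integral_minus)
  then have "Re (\<integral>x. (f x - 1) \<partial>\<Lambda> a) \<le> 0" by (simp only: integral_Re[OF int])
  then show ?thesis unfolding poisson_functional_def norm_exp_eq_Re by simp
qed

lemma step_poisson_functional:
  assumes "step_function f m c B"
  shows "poisson_functional f a = (\<Prod>j<m. exp (of_real (measure (\<Lambda> a) (B j)) * (c j - 1)))"
  unfolding poisson_functional_def
  by (simp add: step_function_integral[OF assms finite_kernel sets_kernel] exp_sum)

lemma measurable_poisson_functional:
  assumes f: "f \<in> borel_measurable borel" and bd: "\<And>x. norm (f x) \<le> R"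
  shows "poisson_functional f \<in> borel_measurable borel"
proof -
  have bd': "norm (f x) \<le> \<bar>R\<bar> + 1" for x using bd[of x] by linarith
  obtain g where g: "\<And>i. simple_function borel (g i)" "\<And>i x. norm (g i x) \<le> \<bar>R\<bar> + 1"
      "\<And>x. (\<lambda>i. g i x) \<longlonglongrightarrow> f x"
    using bounded_measurable_step_approximation[OF f bd'] by (metis abs_ge_zero add_nonneg_pos zero_less_one)
  have gm: "g i \<in> borel_measurable borel" for i
    using g(1) by (rule borel_measurable_simple_function)
  show ?thesis
  proof (rule borel_measurable_LIMSEQ_metric)
    show "(\<lambda>i. poisson_functional (g i) a) \<longlonglongrightarrow> poisson_functional f a" for a
      using g by (intro tendsto_poisson_functional[OF gm f g(2)]) auto
    fix i
    obtain m c B where s: "step_function (g i) m c B"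
      using simple_function_imp_step_function[OF g(1)] by blast
    then have "B j \<in> sets borel" if "j < m" for j using that by (simp add: step_function_def)
    then have "(\<lambda>a. \<Prod>j<m. exp (of_real (measure (\<Lambda> a) (B j)) * (c j - 1)) :: complex)
        \<in> borel_measurable borel"
      by (intro borel_measurable_prod measurable_compose[OF _ borel_measurable_exp]
          borel_measurable_times borel_measurable_const
          measurable_compose[OF measurable_kernel borel_measurable_of_real]) auto
    then show "poisson_functional (g i) \<in> borel_measurable borel"
      by (simp add: step_poisson_functional[OF s, abs_def])
  qed
qed

end

section \<open>Offspring counts given the past\<close>

locale GW_tree = bounded_kernel \<Lambda> C for \<Lambda> C +
  fixes M :: "'w measure" and \<mu> :: "real measure" and H :: "'w \<Rightarrow> aged_tree"
  assumes GW: "multitype_GW_tree M \<mu> \<Lambda> H"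
begin

sublocale prob_space M
  using GW by (simp add: multitype_GW_tree_def)

lemma tree [simp]: "\<omega> \<in> space M \<Longrightarrow> is_aged_tree (H \<omega>)"
  using GW by (simp add: multitype_GW_tree_def)

lemma measurable_H: "H \<in> measurable M (tree_algebra UNIV)"
  using GW by (simp add: multitype_GW_tree_def)

abbreviation past :: "nat \<Rightarrow> 'w measure" where
  "past n \<equiv> upto_generation M H n"

lemma subalgebra_past: "subalgebra M (past n)"
  by (rule subalgebra_upto_generation[OF measurable_H])

lemma measurable_past: "Y \<in> measurable (past n) N \<Longrightarrow> Y \<in> measurable M N"
  by (rule measurable_from_subalg[OF subalgebra_past])

lemma measurable_past_mono:
  assumes "n \<le> n'" "Y \<in> measurable (past n) N" shows "Y \<in> measurable (past n') N"
proof -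
  have "sets (tree_algebra {v. length v \<le> n}) \<subseteq> sets (tree_algebra {v. length v \<le> n'})"
    using assms(1) by (intro sets_tree_algebra_mono) auto
  then have "subalgebra (past n') (past n)"
    unfolding subalgebra_def upto_generation_def by (auto simp: sets_vimage_algebra2)
  then show ?thesis using assms(2) by (rule measurable_from_subalg)
qed

definition rate :: "nat list \<Rightarrow> real set \<Rightarrow> 'w \<Rightarrow> real" where
  "rate v B \<omega> = (case H \<omega> v of None \<Rightarrow> 0 | Some a \<Rightarrow> measure (\<Lambda> a) B)"

definition vertex_weight :: "(real \<Rightarrow> complex) \<Rightarrow> nat list \<Rightarrow> 'w \<Rightarrow> complex" where
  "vertex_weight f v \<omega> = (case H \<omega> v of None \<Rightarrow> 1 | Some a \<Rightarrow> f a)"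

lemma measurable_vertex_weight:
  "f \<in> borel_measurable borel \<Longrightarrow> vertex_weight f v \<in> borel_measurable M"
  unfolding vertex_weight_def by (rule measurable_compose[OF measurable_H measurable_vertex_age]) auto

lemma measurable_rate: "B \<in> sets borel \<Longrightarrow> rate v B \<in> borel_measurable M"
  unfolding rate_def
  by (rule measurable_compose[OF measurable_H measurable_vertex_age]) (auto intro: measurable_kernel)

lemma rate_nonneg: "0 \<le> rate v B \<omega>"
  by (auto simp: rate_def split: option.split)

lemma rate_le: "rate v B \<omega> \<le> C"
proof -
  have "measure (\<Lambda> a) B \<le> C" for a
    using finite_measure.bounded_measure[OF finite_kernel, of a B] kernel_le[of a]
    by (simp add: space_kernel)
  then show ?thesis using C_nonneg by (simp add: rate_def split: option.split)
qed

lemma measurable_offspring_prod: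
  assumes f: "f \<in> borel_measurable borel"
  shows "(\<lambda>\<omega>. offspring_prod f (H \<omega>) v) \<in> borel_measurable M"
proof (rule borel_measurable_LIMSEQ_metric)
  show "(\<lambda>\<omega>. \<Prod>i<K. vertex_weight f (v @ [i]) \<omega>) \<in> borel_measurable M" for K
    by (intro borel_measurable_prod measurable_vertex_weight f)
  fix \<omega> assume "\<omega> \<in> space M"
  let ?I = "{i. v @ [i] \<in> dom (H \<omega>)}"
  have ch: "children (H \<omega>) v = (\<lambda>i. v @ [i]) ` ?I" by (auto simp: children_def)
  have inj: "inj_on (\<lambda>i. v @ [i]) ?I" by (auto simp: inj_on_def)
  have fin: "finite ?I"
    using finite_children[OF tree[OF \<open>\<omega> \<in> space M\<close>], of v] unfolding ch
    by (simp add: finite_image_iff inj)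
  have "offspring_prod f (H \<omega>) v = (\<Prod>w\<in>children (H \<omega>) v. f (the (H \<omega> w)))"
    by (rule offspring_prod_children)
  also have "\<dots> = (\<Prod>i\<in>?I. vertex_weight f (v @ [i]) \<omega>)"
    unfolding ch prod.reindex[OF inj] by (rule prod.cong) (auto simp: vertex_weight_def)
  finally have N: "offspring_prod f (H \<omega>) v = (\<Prod>i\<in>?I. vertex_weight f (v @ [i]) \<omega>)" .
  obtain K0 where K0: "?I \<subseteq> {..<K0}" using fin by (meson finite_nat_iff_bounded)
  have "(\<Prod>i<K. vertex_weight f (v @ [i]) \<omega>) = offspring_prod f (H \<omega>) v" if "K \<ge> K0" for K
    unfolding N using K0 that
    by (intro prod.mono_neutral_right) (auto simp: vertex_weight_def split: option.splits)
  then show "(\<lambda>K. \<Prod>i<K. vertex_weight f (v @ [i]) \<omega>) \<longlonglongrightarrow> offspring_prod f (H \<omega>) v"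
    by (intro tendsto_eventually) (auto simp: eventually_sequentially)
qed

lemma measurable_vertex_poisson_functional:
  assumes "f \<in> borel_measurable borel" "\<And>x. norm (f x) \<le> R"
  shows "vertex_weight (poisson_functional f) v \<in> borel_measurable M"
  by (rule measurable_vertex_weight[OF measurable_poisson_functional[OF assms]])

lemma norm_vertex_weight_le:
  assumes "\<And>x. norm (f x) \<le> R" "1 \<le> R" shows "norm (vertex_weight f v \<omega>) \<le> R"
  using assms by (simp add: vertex_weight_def split: option.split)

text \<open>
  This is the defining property of the tree with the conditional expectation removed: the
  probabilities are tested against an integrable weight \<open>Y\<close> that depends on the past. The weight
  is complex, so the real statement is applied to its two components.
\<close>

lemma integral_offspring_counts:
  fixes k :: "nat list \<times> nat \<Rightarrow> nat" and Y :: "'w \<Rightarrow> complex"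
  assumes J: "finite J" "J \<subseteq> {v. length v = n}"
    and B: "\<And>j. j < m \<Longrightarrow> B j \<in> sets borel" "disjoint_family_on B {..<m}"
    and Y: "Y \<in> borel_measurable (past n)" "integrable M Y"
  defines "p \<equiv> \<lambda>\<omega>. \<Prod>i\<in>J \<times> {..<m}. poisson_prob (rate (fst i) (B (snd i)) \<omega>) (k i)"
    and "E \<equiv> {\<omega> \<in> space M. \<forall>i\<in>J \<times> {..<m}.
            size {#x \<in># children_ages (H \<omega>) (fst i). x \<in> B (snd i)#} = k i}"
  shows "integrable M (\<lambda>\<omega>. Y \<omega> * of_real (indicator E \<omega>))"
    and "integrable M (\<lambda>\<omega>. Y \<omega> * of_real (p \<omega>))"
    and "(\<integral>\<omega>. Y \<omega> * of_real (indicator E \<omega>) \<partial>M) = (\<integral>\<omega>. Y \<omega> * of_real (p \<omega>) \<partial>M)"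
proof -
  interpret F: finite_measure_subalgebra M "past n"
    by unfold_locales (rule subalgebra_past)
  have [measurable]: "Y \<in> borel_measurable M" using Y(1) by (rule measurable_past)
  have "{\<omega> \<in> space M. size {#x \<in># children_ages (H \<omega>) (fst i). x \<in> B (snd i)#} = k i} \<in> sets M"
    if "i \<in> J \<times> {..<m}" for i
  proof -
    have "(\<lambda>\<omega>. size {#x \<in># children_ages (H \<omega>) (fst i). x \<in> B (snd i)#})
        \<in> measurable M (count_space UNIV)"
      using that B(1) by (intro measurable_offspring_count measurable_H) auto
    from measurable_sets[OF this, of "{k i}"] show ?thesis
      by (simp add: vimage_def Int_def conj_commute)
  qed
  then have E [measurable]: "E \<in> sets M"
    unfolding E_def using J(1) by (intro sets.sets_Collect_finite_All) auto
  have [measurable]: "p \<in> borel_measurable M"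
    unfolding p_def poisson_prob_def using B(1)
    by (intro borel_measurable_prod borel_measurable_divide borel_measurable_times
        borel_measurable_power borel_measurable_const measurable_rate
        measurable_compose[OF _ borel_measurable_exp] borel_measurable_uminus) auto
  have ae: "AE \<omega> in M. real_cond_exp M (past n) (indicator E) \<omega> = p \<omega>"
  proof -
    have cond: "cond_indep_poisson_measures M (past n) {v. length v = n}
            (\<lambda>v \<omega>. children_ages (H \<omega>) v)
            (\<lambda>v \<omega>. case H \<omega> v of None \<Rightarrow> null_measure borel | Some a \<Rightarrow> \<Lambda> a)"
      using GW unfolding multitype_GW_tree_def upto_generation_def by blast
    have E': "E = {\<omega> \<in> space M. \<forall>v\<in>J. \<forall>j<m.
        size {#x \<in># children_ages (H \<omega>) v. x \<in> B j#} = (\<lambda>v j. k (v, j)) v j}"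
      unfolding E_def by auto
    have p': "p \<omega> = (\<Prod>v\<in>J. \<Prod>j<m. poisson_prob (measure
        (case H \<omega> v of None \<Rightarrow> null_measure borel | Some a \<Rightarrow> \<Lambda> a) (B j)) ((\<lambda>v j. k (v, j)) v j))" for \<omega>
    proof -
      have r: "rate v (B j) \<omega> = measure
        (case H \<omega> v of None \<Rightarrow> null_measure borel | Some a \<Rightarrow> \<Lambda> a) (B j)" for v j
        by (simp add: rate_def split: option.split)
      show ?thesis unfolding p_def prod.cartesian_product r by (simp add: case_prod_unfold)
    qed
    show ?thesis unfolding p' unfolding E'
      using cond[unfolded cond_indep_poisson_measures_def, rule_format,
          of J m "\<lambda>_. B" "\<lambda>v j. k (v, j)"] J B by blast
  qed
  show intE: "integrable M (\<lambda>\<omega>. Y \<omega> * of_real (indicator E \<omega>))"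
    by (rule Bochner_Integration.integrable_bound[OF Y(2)]) (auto simp: indicator_def)
  have real: "integrable M (\<lambda>\<omega>. y \<omega> * p \<omega>) \<and>
       (\<integral>\<omega>. y \<omega> * indicator E \<omega> \<partial>M) = (\<integral>\<omega>. y \<omega> * p \<omega> \<partial>M)"
    if y: "y \<in> borel_measurable (past n)" "integrable M y" for y :: "'w \<Rightarrow> real"
  proof -
    have [measurable]: "y \<in> borel_measurable M" using y(1) by (rule measurable_past)
    have i: "integrable M (\<lambda>\<omega>. y \<omega> * indicator E \<omega>)"
      by (rule Bochner_Integration.integrable_bound[OF y(2)]) (auto simp: indicator_def)
    have "indicator E \<in> borel_measurable M" by measurable
    note c = F.real_cond_exp_intg[OF i y(1) this]
    have eq: "AE \<omega> in M. y \<omega> * real_cond_exp M (past n) (indicator E) \<omega> = y \<omega> * p \<omega>"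
      using ae by eventually_elim simp
    show ?thesis
      using c integrable_cong_AE[OF _ _ eq] integral_cong_AE[OF _ _ eq] by simp
  qed
  have re: "(\<lambda>\<omega>. Re (Y \<omega>)) \<in> borel_measurable (past n)" "integrable M (\<lambda>\<omega>. Re (Y \<omega>))"
    and im: "(\<lambda>\<omega>. Im (Y \<omega>)) \<in> borel_measurable (past n)" "integrable M (\<lambda>\<omega>. Im (Y \<omega>))"
    using Y by (auto intro: measurable_compose[OF _ borel_measurable_Re]
        measurable_compose[OF _ borel_measurable_Im])
  show intp: "integrable M (\<lambda>\<omega>. Y \<omega> * of_real (p \<omega>))"
  proof -
    have "integrable M (\<lambda>\<omega>. of_real (Re (Y \<omega>) * p \<omega>) + \<i> * of_real (Im (Y \<omega>) * p \<omega>))"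
      using real[OF re] real[OF im] by (intro Bochner_Integration.integrable_add integrable_mult_right
          integrable_of_real) auto
    also have "(\<lambda>\<omega>. of_real (Re (Y \<omega>) * p \<omega>) + \<i> * of_real (Im (Y \<omega>) * p \<omega>)) =
        (\<lambda>\<omega>. Y \<omega> * of_real (p \<omega>))"
      by (simp add: complex_eq_iff fun_eq_iff)
    finally show ?thesis .
  qed
  show "(\<integral>\<omega>. Y \<omega> * of_real (indicator E \<omega>) \<partial>M) = (\<integral>\<omega>. Y \<omega> * of_real (p \<omega>) \<partial>M)"
    using real[OF re] real[OF im]
    by (simp add: complex_eq_iff integral_Re[OF intE, symmetric] integral_Im[OF intE, symmetric]
        integral_Re[OF intp, symmetric] integral_Im[OF intp, symmetric])
qed

end

section \<open>The generating functional of one generation\<close>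

lemma poisson_prob_sums:
  fixes c :: complex
  shows "(\<lambda>k. c ^ k * of_real (poisson_prob r k)) sums exp (of_real r * (c - 1))"
proof -
  have "(\<lambda>k. exp (- of_real r) * ((of_real r * c) ^ k /\<^sub>R fact k)) sums
      (exp (- of_real r) * exp (of_real r * c))"
    by (intro sums_mult exp_converges)
  moreover have "exp (- of_real r) * exp (of_real r * c) = exp (of_real r * (c - 1))"
    by (simp add: exp_add[symmetric] algebra_simps)
  moreover have "exp (- of_real r) * ((of_real r * c) ^ k /\<^sub>R fact k) =
      c ^ k * of_real (poisson_prob r k)" for k
    by (simp add: poisson_prob_def exp_of_real[symmetric] scaleR_conv_of_real power_mult_distrib field_simps)
  ultimately show ?thesis by simp
qed

text \<open>
  The bound is uniform in the truncation \<open>K\<close> and in the rate, for dominated convergence.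
\<close>

lemma norm_poisson_partial_sum_le:
  fixes c :: complex
  assumes "norm c \<le> R" "0 \<le> r" "r \<le> C"
  shows "norm (\<Sum>k<K. c ^ k * of_real (poisson_prob r k)) \<le> exp (R * C)"
proof -
  have R: "0 \<le> R" using assms(1) norm_ge_zero[of c] by linarith
  have le: "norm (c ^ k * of_real (poisson_prob r k)) \<le> (R * C) ^ k /\<^sub>R fact k" for k
  proof -
    have "norm (c ^ k * of_real (poisson_prob r k)) = norm c ^ k * (exp (- r) * r ^ k / fact k)"
      using assms by (simp add: norm_mult norm_power norm_divide poisson_prob_def)
    also have "\<dots> \<le> R ^ k * (1 * C ^ k / fact k)"
      using assms R by (intro mult_mono divide_right_mono power_mono) auto
    finally show ?thesis by (simp add: power_mult_distrib field_simps)
  qed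
  have "norm (\<Sum>k<K. c ^ k * of_real (poisson_prob r k)) \<le> (\<Sum>k<K. (R * C) ^ k /\<^sub>R fact k)"
    by (rule order_trans[OF norm_sum sum_mono[OF le]])
  also have "\<dots> \<le> exp (R * C)"
    unfolding sums_unique[OF exp_converges[of "R * C"]]
    using R assms by (intro sum_le_suminf summable_exp_generic) auto
  finally show ?thesis .
qed

lemma offspring_prod_step:
  assumes "step_function f m c B"
  shows "offspring_prod f t v = (\<Prod>j<m. c j ^ size {#x \<in># children_ages t v. x \<in> B j#})"
  unfolding offspring_prod_def
  using assms by (intro step_function_prod_mset) (auto simp: step_function_def)

lemma norm_offspring_prod_le:
  assumes "\<And>x. norm (f x) \<le> R" 
  shows "norm (offspring_prod f t v) \<le> R ^ size (children_ages t v)"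
proof -
  have "norm (offspring_prod f t v) \<le> (\<Prod>w\<in>children t v. R)"
    unfolding offspring_prod_children prod_norm[symmetric] using assms by (intro prod_mono) auto
  then show ?thesis by (simp add: children_ages_def)
qed

context GW_tree
begin

text \<open>
  The generating function of independent Poisson counts. Both sides are first truncated to counts
  below \<open>K\<close>: the product of the truncated sums expands into a finite sum over count vectors \<open>g\<close>, to
  which \<open>integral_offspring_counts\<close> applies term by term. Then \<open>K\<close> tends to infinity. Values of
  modulus above \<open>1\<close> are needed for the factor \<open>s ^ deg(\<rho>)\<close>, hence the integrability condition with
  \<open>R\<close>.
\<close>

lemma step_generating_functional:
  assumes J: "finite J" "J \<subseteq> {v. length v = n}"
    and f: "step_function f m c B" "\<And>x. norm (f x) \<le> R" and R: "1 \<le> R"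
    and Y: "Y \<in> borel_measurable (past n)" "integrable M Y"
    and dom: "integrable M (\<lambda>\<omega>. norm (Y \<omega>) * (\<Prod>v\<in>J. R ^ size (children_ages (H \<omega>) v)))"
  shows "(\<integral>\<omega>. Y \<omega> * (\<Prod>v\<in>J. offspring_prod f (H \<omega>) v) \<partial>M) =
         (\<integral>\<omega>. Y \<omega> * (\<Prod>v\<in>J. vertex_weight (poisson_functional f) v \<omega>) \<partial>M)"
proof -
  let ?I = "J \<times> {..<m}"
  define N where "N i \<omega> = size {#x \<in># children_ages (H \<omega>) (fst i). x \<in> B (snd i)#}" for i \<omega>
  define r where "r i = rate (fst i) (B (snd i))" for i
  define d where "d i = c (snd i)" for i :: "nat list \<times> nat"
  define X where "X K \<omega> = (\<Prod>i\<in>?I. \<Sum>k<K. if N i \<omega> = k then d i ^ k else 0)" for K \<omega>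
  define P where "P K \<omega> = (\<Prod>i\<in>?I. \<Sum>k<K. d i ^ k * of_real (poisson_prob (r i \<omega>) k))" for K \<omega>
  define E where "E k = {\<omega> \<in> space M. \<forall>i\<in>?I. N i \<omega> = k i}" for k
  have fin: "finite ?I" using J(1) by simp
  have B: "\<And>j. j < m \<Longrightarrow> B j \<in> sets borel" "disjoint_family_on B {..<m}" "(\<Union>j<m. B j) = UNIV"
    using f(1) by (auto simp: step_function_def)
  have d: "norm (d i) \<le> R" if "i \<in> ?I" for i
  proof -
    have "d i \<in> range f" using that f(1) by (auto simp: step_function_def d_def)
    then show ?thesis using f(2) by auto
  qed
  note counts = integral_offspring_counts[OF J B(1,2) Y, folded N_def r_def, folded E_def]
  have [measurable]: "Y \<in> borel_measurable M" using Y(1) by (rule measurable_past)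
  have [measurable]: "N i \<in> measurable M (count_space UNIV)" if "i \<in> ?I" for i
    unfolding N_def using that B(1) by (intro measurable_offspring_count measurable_H tree) auto
  have [measurable]: "r i \<in> borel_measurable M" if "i \<in> ?I" for i
    unfolding r_def using that B(1) by (intro measurable_rate) auto
  have X_meas: "X K \<in> borel_measurable M" for K
    unfolding X_def by (intro borel_measurable_prod borel_measurable_sum) measurable
  have P_meas: "P K \<in> borel_measurable M" for K
    unfolding P_def poisson_prob_def by (intro borel_measurable_prod borel_measurable_sum) measurable

  have eq: "(\<integral>\<omega>. Y \<omega> * X K \<omega> \<partial>M) = (\<integral>\<omega>. Y \<omega> * P K \<omega> \<partial>M)" for K
  proof -
    let ?G = "PiE ?I (\<lambda>_. {..<K})"
    let ?d = "\<lambda>g. \<Prod>i\<in>?I. d i ^ g i"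
    have finG: "finite ?G" using fin by (intro finite_PiE) auto
    have "(\<integral>\<omega>. Y \<omega> * X K \<omega> \<partial>M) =
        (\<integral>\<omega>. (\<Sum>g\<in>?G. ?d g * (Y \<omega> * of_real (indicator (E g) \<omega>))) \<partial>M)"
    proof (rule Bochner_Integration.integral_cong)
      fix \<omega> assume \<omega>: "\<omega> \<in> space M"
      have "(\<Prod>i\<in>?I. if N i \<omega> = g i then d i ^ g i else 0) = ?d g * of_real (indicator (E g) \<omega>)" for g
      proof (cases "\<forall>i\<in>?I. N i \<omega> = g i")
        case True
        have "(\<Prod>i\<in>?I. if N i \<omega> = g i then d i ^ g i else 0) = ?d g"
          by (rule prod.cong[OF refl]) (use True in auto)
        moreover have "indicator (E g) \<omega> = (1::real)" using \<omega> True by (simp add: E_def)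
        ultimately show ?thesis by simp
      next
        case False
        then have "(\<Prod>i\<in>?I. if N i \<omega> = g i then d i ^ g i else 0) = 0"
          using fin by (intro prod_zero) auto
        then show ?thesis using False by (auto simp: E_def)
      qed
      then show "Y \<omega> * X K \<omega> = (\<Sum>g\<in>?G. ?d g * (Y \<omega> * of_real (indicator (E g) \<omega>)))"
        unfolding X_def by (subst prod_sum_PiE) (simp_all add: fin sum_distrib_left mult_ac)
    qed simp
    also have "\<dots> = (\<Sum>g\<in>?G. ?d g * (\<integral>\<omega>. Y \<omega> * of_real (indicator (E g) \<omega>) \<partial>M))"
      by (subst Bochner_Integration.integral_sum) (auto intro!: integrable_mult_right counts(1))
    also have "\<dots> = (\<Sum>g\<in>?G. ?d g *
        (\<integral>\<omega>. Y \<omega> * of_real (\<Prod>i\<in>?I. poisson_prob (r i \<omega>) (g i)) \<partial>M))"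
      by (simp only: counts(3))
    also have "\<dots> = (\<integral>\<omega>. (\<Sum>g\<in>?G. ?d g *
        (Y \<omega> * of_real (\<Prod>i\<in>?I. poisson_prob (r i \<omega>) (g i)))) \<partial>M)"
      by (subst Bochner_Integration.integral_sum) (auto intro!: integrable_mult_right counts(2) simp del: of_real_prod)
    also have "\<dots> = (\<integral>\<omega>. Y \<omega> * P K \<omega> \<partial>M)"
      unfolding P_def
      by (subst prod_sum_PiE) (simp_all add: fin sum_distrib_left mult_ac prod.distrib)
    finally show ?thesis .
  qed

  have X_lim: "(\<lambda>K. X K \<omega>) \<longlonglongrightarrow> (\<Prod>v\<in>J. offspring_prod f (H \<omega>) v)" for \<omega>
  proof -
    have "(\<Prod>v\<in>J. offspring_prod f (H \<omega>) v) = (\<Prod>i\<in>?I. d i ^ N i \<omega>)"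
      by (simp add: offspring_prod_step[OF f(1)] prod.cartesian_product case_prod_unfold d_def N_def)
    moreover have "(\<lambda>K. \<Sum>k<K. if N i \<omega> = k then d i ^ k else 0) \<longlonglongrightarrow> d i ^ N i \<omega>" for i
      by (rule tendsto_eventually, rule eventually_sequentiallyI[of "Suc (N i \<omega>)"]) auto
    ultimately show ?thesis unfolding X_def by (auto intro: tendsto_prod)
  qed
  have X_le: "norm (X K \<omega>) \<le> (\<Prod>v\<in>J. R ^ size (children_ages (H \<omega>) v))" for K \<omega>
  proof -
    have "norm (X K \<omega>) \<le> (\<Prod>i\<in>?I. R ^ N i \<omega>)"
      unfolding X_def prod_norm[symmetric]
    proof (intro prod_mono conjI norm_ge_zero)
      fix i assume "i \<in> ?I"
      then have "norm (d i) ^ N i \<omega> \<le> R ^ N i \<omega>" by (intro power_mono d) auto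
      then show "norm (\<Sum>k<K. if N i \<omega> = k then d i ^ k else 0) \<le> R ^ N i \<omega>"
        using R by (simp add: norm_power)
    qed
    also have "\<dots> = (\<Prod>v\<in>J. \<Prod>j<m. R ^ size {#x \<in># children_ages (H \<omega>) v. x \<in> B j#})"
      by (simp add: prod.cartesian_product case_prod_unfold N_def)
    also have "\<dots> = (\<Prod>v\<in>J. R ^ size (children_ages (H \<omega>) v))"
    proof (rule prod.cong[OF refl])
      fix v
      show "(\<Prod>j<m. R ^ size {#x \<in># children_ages (H \<omega>) v. x \<in> B j#}) = R ^ size (children_ages (H \<omega>) v)"
        using step_function_prod_mset[OF B(2,3), of "\<lambda>_. R" "\<lambda>_. R" "children_ages (H \<omega>) v"]
        by (simp only: prod_mset_constant)
    qed
    finally show ?thesis .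
  qed
  have P_lim: "(\<lambda>K. P K \<omega>) \<longlonglongrightarrow> (\<Prod>v\<in>J. vertex_weight (poisson_functional f) v \<omega>)" for \<omega>
  proof -
    have "vertex_weight (poisson_functional f) v \<omega> =
        (\<Prod>j<m. exp (of_real (rate v (B j) \<omega>) * (c j - 1)))" for v
      by (simp add: vertex_weight_def rate_def step_poisson_functional[OF f(1)] split: option.split)
    then have "(\<Prod>v\<in>J. vertex_weight (poisson_functional f) v \<omega>) =
        (\<Prod>i\<in>?I. exp (of_real (r i \<omega>) * (d i - 1)))"
      by (simp add: prod.cartesian_product case_prod_unfold d_def r_def)
    then show ?thesis unfolding P_def
      using poisson_prob_sums by (auto intro!: tendsto_prod simp: sums_def)
  qed
  have P_le: "norm (P K \<omega>) \<le> (\<Prod>i\<in>?I. exp (R * C))" for K \<omega>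
    unfolding P_def prod_norm[symmetric]
    by (intro prod_mono conjI norm_ge_zero norm_poisson_partial_sum_le d)
      (auto simp: r_def rate_nonneg rate_le)

  have "(\<lambda>K. \<integral>\<omega>. Y \<omega> * X K \<omega> \<partial>M) \<longlonglongrightarrow> (\<integral>\<omega>. Y \<omega> * (\<Prod>v\<in>J. offspring_prod f (H \<omega>) v) \<partial>M)"
  proof (rule integral_dominated_convergence[OF _ _ dom])
    have "f \<in> borel_measurable borel"
    proof (rule measurableI)
      fix S :: "complex set"
      have "f x \<in> S \<longleftrightarrow> (\<exists>j<m. c j \<in> S \<and> x \<in> B j)" for x
      proof -
        obtain j where "j < m" "x \<in> B j" using B(3) by blast
        then show ?thesis using f(1) unfolding step_function_def by metis
      qed
      then have "f -` S \<inter> space borel = (\<Union>j\<in>{j. j < m \<and> c j \<in> S}. B j)" by auto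
      also have "\<dots> \<in> sets borel" using B(1) by auto
      finally show "f -` S \<inter> space borel \<in> sets borel" .
    qed simp
    then show "(\<lambda>\<omega>. Y \<omega> * (\<Prod>v\<in>J. offspring_prod f (H \<omega>) v)) \<in> borel_measurable M"
      by (intro borel_measurable_times borel_measurable_prod measurable_offspring_prod) simp_all
    show "(\<lambda>\<omega>. Y \<omega> * X K \<omega>) \<in> borel_measurable M" for K using X_meas by measurable
    show "AE \<omega> in M. (\<lambda>K. Y \<omega> * X K \<omega>) \<longlonglongrightarrow> Y \<omega> * (\<Prod>v\<in>J. offspring_prod f (H \<omega>) v)"
      using X_lim by (intro AE_I2 tendsto_mult tendsto_const)
    show "AE \<omega> in M. norm (Y \<omega> * X K \<omega>) \<le>
        norm (Y \<omega>) * (\<Prod>v\<in>J. R ^ size (children_ages (H \<omega>) v))" for K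
      using X_le by (intro AE_I2) (simp add: norm_mult mult_left_mono)
  qed
  moreover have "(\<lambda>K. \<integral>\<omega>. Y \<omega> * P K \<omega> \<partial>M) \<longlonglongrightarrow>
      (\<integral>\<omega>. Y \<omega> * (\<Prod>v\<in>J. vertex_weight (poisson_functional f) v \<omega>) \<partial>M)"
  proof (rule integral_dominated_convergence[where w="\<lambda>\<omega>. norm (Y \<omega>) * (\<Prod>i\<in>?I. exp (R * C))"])
    show P_meas': "(\<lambda>\<omega>. Y \<omega> * P K \<omega>) \<in> borel_measurable M" for K using P_meas by measurable
    show lim: "AE \<omega> in M. (\<lambda>K. Y \<omega> * P K \<omega>) \<longlonglongrightarrow>
        Y \<omega> * (\<Prod>v\<in>J. vertex_weight (poisson_functional f) v \<omega>)"
      using P_lim by (intro AE_I2 tendsto_mult tendsto_const)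
    show "(\<lambda>\<omega>. Y \<omega> * (\<Prod>v\<in>J. vertex_weight (poisson_functional f) v \<omega>)) \<in> borel_measurable M"
      using P_lim by (intro borel_measurable_LIMSEQ_metric[OF P_meas'] tendsto_mult tendsto_const)
    show "AE \<omega> in M. norm (Y \<omega> * P K \<omega>) \<le> norm (Y \<omega>) * (\<Prod>i\<in>?I. exp (R * C))" for K
      using P_le by (intro AE_I2) (simp add: norm_mult mult_left_mono)
    show "integrable M (\<lambda>\<omega>. norm (Y \<omega>) * (\<Prod>i\<in>?I. exp (R * C)))"
      using Y(2) by (intro integrable_mult_left integrable_norm)
  qed
  ultimately show ?thesis unfolding eq by (rule LIMSEQ_unique)
qed

lemma finite_generating_functional:
  assumes J: "finite J" "J \<subseteq> {v. length v = n}"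
    and f: "f \<in> borel_measurable borel" "\<And>x. norm (f x) \<le> R" and R: "1 \<le> R"
    and Y: "Y \<in> borel_measurable (past n)" "integrable M Y"
    and dom: "integrable M (\<lambda>\<omega>. norm (Y \<omega>) * (\<Prod>v\<in>J. R ^ size (children_ages (H \<omega>) v)))"
  shows "(\<integral>\<omega>. Y \<omega> * (\<Prod>v\<in>J. offspring_prod f (H \<omega>) v) \<partial>M) =
         (\<integral>\<omega>. Y \<omega> * (\<Prod>v\<in>J. vertex_weight (poisson_functional f) v \<omega>) \<partial>M)"
proof -
  obtain g where g: "\<And>i. simple_function borel (g i)" "\<And>i x. norm (g i x) \<le> R"
      "\<And>x. (\<lambda>i. g i x) \<longlonglongrightarrow> f x"
    using bounded_measurable_step_approximation[OF f] R by (metis less_le_trans zero_less_one)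
  have gm: "g i \<in> borel_measurable borel" for i
    using g(1) by (rule borel_measurable_simple_function)
  have Ym: "Y \<in> borel_measurable M" using Y(1) by (rule measurable_past)
  have eq: "(\<integral>\<omega>. Y \<omega> * (\<Prod>v\<in>J. offspring_prod (g i) (H \<omega>) v) \<partial>M) =
         (\<integral>\<omega>. Y \<omega> * (\<Prod>v\<in>J. vertex_weight (poisson_functional (g i)) v \<omega>) \<partial>M)" for i
  proof -
    obtain m c B where "step_function (g i) m c B"
      using simple_function_imp_step_function[OF g(1)] by blast
    from step_generating_functional[OF J this g(2) R Y dom] show ?thesis .
  qed
  have "(\<lambda>i. \<integral>\<omega>. Y \<omega> * (\<Prod>v\<in>J. offspring_prod (g i) (H \<omega>) v) \<partial>M) \<longlonglongrightarrow>
      (\<integral>\<omega>. Y \<omega> * (\<Prod>v\<in>J. offspring_prod f (H \<omega>) v) \<partial>M)"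
  proof (rule integral_dominated_convergence[OF _ _ dom])
    show "(\<lambda>\<omega>. Y \<omega> * (\<Prod>v\<in>J. offspring_prod f (H \<omega>) v)) \<in> borel_measurable M"
      by (intro borel_measurable_times borel_measurable_prod measurable_offspring_prod f Ym)
    show "(\<lambda>\<omega>. Y \<omega> * (\<Prod>v\<in>J. offspring_prod (g i) (H \<omega>) v)) \<in> borel_measurable M" for i
      by (intro borel_measurable_times borel_measurable_prod measurable_offspring_prod gm Ym)
    show "AE \<omega> in M. (\<lambda>i. Y \<omega> * (\<Prod>v\<in>J. offspring_prod (g i) (H \<omega>) v)) \<longlonglongrightarrow>
        Y \<omega> * (\<Prod>v\<in>J. offspring_prod f (H \<omega>) v)"
      unfolding offspring_prod_children
      by (intro AE_I2 tendsto_mult tendsto_const tendsto_prod g(3))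
    show "AE \<omega> in M. norm (Y \<omega> * (\<Prod>v\<in>J. offspring_prod (g i) (H \<omega>) v)) \<le>
        norm (Y \<omega>) * (\<Prod>v\<in>J. R ^ size (children_ages (H \<omega>) v))" for i
      unfolding norm_mult prod_norm[symmetric]
      by (intro AE_I2 mult_left_mono prod_mono conjI norm_ge_zero norm_offspring_prod_le g(2))
  qed
  moreover have "(\<lambda>i. \<integral>\<omega>. Y \<omega> * (\<Prod>v\<in>J. vertex_weight (poisson_functional (g i)) v \<omega>) \<partial>M) \<longlonglongrightarrow>
      (\<integral>\<omega>. Y \<omega> * (\<Prod>v\<in>J. vertex_weight (poisson_functional f) v \<omega>) \<partial>M)"
  proof (rule integral_dominated_convergence[where w="\<lambda>\<omega>. norm (Y \<omega>) * (\<Prod>v\<in>J. exp ((R + 1) * C))"])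
    show "(\<lambda>\<omega>. Y \<omega> * (\<Prod>v\<in>J. vertex_weight (poisson_functional f) v \<omega>)) \<in> borel_measurable M"
      by (intro borel_measurable_times borel_measurable_prod
          measurable_vertex_poisson_functional[OF f] Ym)
    show "(\<lambda>\<omega>. Y \<omega> * (\<Prod>v\<in>J. vertex_weight (poisson_functional (g i)) v \<omega>)) \<in> borel_measurable M" for i
      by (intro borel_measurable_times borel_measurable_prod
          measurable_vertex_poisson_functional[OF gm g(2)] Ym)
    have "(\<lambda>i. vertex_weight (poisson_functional (g i)) v \<omega>) \<longlonglongrightarrow>
        vertex_weight (poisson_functional f) v \<omega>" for v \<omega>
      using tendsto_poisson_functional[OF gm f(1) g(2)] g(3)
      by (simp add: vertex_weight_def split: option.split)
    then show "AE \<omega> in M. (\<lambda>i. Y \<omega> * (\<Prod>v\<in>J. vertex_weight (poisson_functional (g i)) v \<omega>)) \<longlonglongrightarrow>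
        Y \<omega> * (\<Prod>v\<in>J. vertex_weight (poisson_functional f) v \<omega>)"
      by (intro AE_I2 tendsto_mult tendsto_const tendsto_prod)
    have "1 \<le> exp ((R + 1) * C)" using R C_nonneg by simp
    then show "AE \<omega> in M. norm (Y \<omega> * (\<Prod>v\<in>J. vertex_weight (poisson_functional (g i)) v \<omega>)) \<le>
        norm (Y \<omega>) * (\<Prod>v\<in>J. exp ((R + 1) * C))" for i
      unfolding norm_mult prod_norm[symmetric]
      by (intro AE_I2 mult_left_mono prod_mono conjI norm_ge_zero norm_vertex_weight_le
          norm_poisson_functional_le[OF gm g(2)])
    show "integrable M (\<lambda>\<omega>. norm (Y \<omega>) * (\<Prod>v\<in>J. exp ((R + 1) * C)))"
      using Y(2) by (intro integrable_mult_left integrable_norm)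
  qed
  ultimately show ?thesis unfolding eq by (rule LIMSEQ_unique)
qed

text \<open>
  The branching property of one generation: the children may be integrated out, each vertex \<open>v\<close> of
  generation \<open>n\<close> leaving behind the Poisson functional at its own age. The labels of a level are
  exhausted by finite sets; with \<open>|f| \<le> 1\<close> all products stay bounded by \<open>1\<close>.
\<close>

theorem generation_generating_functional:
  assumes f: "f \<in> borel_measurable borel" "\<And>x. norm (f x) \<le> 1"
    and Y: "Y \<in> borel_measurable (past n)" "integrable M Y"
  shows "(\<integral>\<omega>. Y \<omega> * generation_prod f (Suc n) (H \<omega>) \<partial>M) =
         (\<integral>\<omega>. Y \<omega> * generation_prod (poisson_functional f) n (H \<omega>) \<partial>M)"
proof -
  have Ym: "Y \<in> borel_measurable M" using Y(1) by (rule measurable_past)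
  have Yn: "integrable M (\<lambda>\<omega>. norm (Y \<omega>))" using Y(2) by (rule integrable_norm)
  have gen: "(\<lambda>\<omega>. generation_prod h k (H \<omega>)) \<in> borel_measurable M"
    if "h \<in> borel_measurable borel" for h k
    using that by (intro measurable_past[of _ k] measurable_upto_generation_prod) auto
  have eq: "(\<integral>\<omega>. Y \<omega> * (\<Prod>v\<in>labels n K. offspring_prod f (H \<omega>) v) \<partial>M) =
         (\<integral>\<omega>. Y \<omega> * (\<Prod>v\<in>labels n K. vertex_weight (poisson_functional f) v \<omega>) \<partial>M)" for K
    using Yn by (intro finite_generating_functional[OF finite_labels _ f order_refl Y])
      (auto simp: labels_def)
  have "(\<lambda>K. \<integral>\<omega>. Y \<omega> * (\<Prod>v\<in>labels n K. offspring_prod f (H \<omega>) v) \<partial>M) \<longlonglongrightarrow>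
      (\<integral>\<omega>. Y \<omega> * generation_prod f (Suc n) (H \<omega>) \<partial>M)"
  proof (rule integral_dominated_convergence[OF _ _ Yn])
    show "(\<lambda>\<omega>. Y \<omega> * generation_prod f (Suc n) (H \<omega>)) \<in> borel_measurable M"
      by (intro borel_measurable_times gen f Ym)
    show "(\<lambda>\<omega>. Y \<omega> * (\<Prod>v\<in>labels n K. offspring_prod f (H \<omega>) v)) \<in> borel_measurable M" for K
      by (intro borel_measurable_times borel_measurable_prod measurable_offspring_prod f Ym)
    show "AE \<omega> in M. (\<lambda>K. Y \<omega> * (\<Prod>v\<in>labels n K. offspring_prod f (H \<omega>) v)) \<longlonglongrightarrow>
        Y \<omega> * generation_prod f (Suc n) (H \<omega>)"
    proof (intro AE_I2 tendsto_mult tendsto_const)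
      fix \<omega> assume "\<omega> \<in> space M"
      then have t: "is_aged_tree (H \<omega>)" by simp
      show "(\<lambda>K. \<Prod>v\<in>labels n K. offspring_prod f (H \<omega>) v) \<longlonglongrightarrow> generation_prod f (Suc n) (H \<omega>)"
        unfolding generation_prod_Suc[OF t]
        by (rule tendsto_prod_labels[OF t]) (simp add: offspring_prod_children children_outside[OF t])
    qed
    show "AE \<omega> in M. norm (Y \<omega> * (\<Prod>v\<in>labels n K. offspring_prod f (H \<omega>) v)) \<le> norm (Y \<omega>)" for K
      unfolding norm_mult prod_norm[symmetric]
      by (intro AE_I2 mult_left_le prod_le_1 conjI norm_ge_zero)
        (use norm_offspring_prod_le[OF f(2)] in auto)
  qed
  moreover have "(\<lambda>K. \<integral>\<omega>. Y \<omega> * (\<Prod>v\<in>labels n K. vertex_weight (poisson_functional f) v \<omega>) \<partial>M)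
      \<longlonglongrightarrow> (\<integral>\<omega>. Y \<omega> * generation_prod (poisson_functional f) n (H \<omega>) \<partial>M)"
  proof (rule integral_dominated_convergence[OF _ _ Yn])
    show "(\<lambda>\<omega>. Y \<omega> * generation_prod (poisson_functional f) n (H \<omega>)) \<in> borel_measurable M"
      by (intro borel_measurable_times gen measurable_poisson_functional[OF f] Ym)
    show "(\<lambda>\<omega>. Y \<omega> * (\<Prod>v\<in>labels n K. vertex_weight (poisson_functional f) v \<omega>)) \<in> borel_measurable M" for K
      by (intro borel_measurable_times borel_measurable_prod
          measurable_vertex_poisson_functional[OF f] Ym)
    show "AE \<omega> in M. (\<lambda>K. Y \<omega> * (\<Prod>v\<in>labels n K. vertex_weight (poisson_functional f) v \<omega>)) \<longlonglongrightarrow>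
        Y \<omega> * generation_prod (poisson_functional f) n (H \<omega>)"
    proof (intro AE_I2 tendsto_mult tendsto_const)
      fix \<omega> assume "\<omega> \<in> space M"
      then have t: "is_aged_tree (H \<omega>)" by simp
      have "(\<lambda>K. \<Prod>v\<in>labels n K. vertex_weight (poisson_functional f) v \<omega>) \<longlonglongrightarrow>
          (\<Prod>v\<in>generation (H \<omega>) n. vertex_weight (poisson_functional f) v \<omega>)"
        by (rule tendsto_prod_labels[OF t]) (auto simp: vertex_weight_def split: option.split)
      also have "(\<Prod>v\<in>generation (H \<omega>) n. vertex_weight (poisson_functional f) v \<omega>) =
          generation_prod (poisson_functional f) n (H \<omega>)"
        unfolding generation_prod_def
        by (rule prod.cong) (auto simp: vertex_weight_def generation_def)
      finally show "(\<lambda>K. \<Prod>v\<in>labels n K. vertex_weight (poisson_functional f) v \<omega>) \<longlonglongrightarrow>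
          generation_prod (poisson_functional f) n (H \<omega>)" .
    qed
    show "AE \<omega> in M. norm (Y \<omega> * (\<Prod>v\<in>labels n K. vertex_weight (poisson_functional f) v \<omega>))
        \<le> norm (Y \<omega>)" for K
      unfolding norm_mult prod_norm[symmetric]
      by (intro AE_I2 mult_left_le prod_le_1 conjI norm_ge_zero norm_vertex_weight_le
          norm_poisson_functional_le_1[OF f] order_refl)
  qed
  ultimately show ?thesis unfolding eq by (rule LIMSEQ_unique)
qed

end

section \<open>The total progeny\<close>

context bounded_kernel
begin

text \<open>
  \<open>height_pgf z k a\<close> is the generating function of the size of the tree with root age \<open>a\<close>, restricted
  to trees with at most \<open>k\<close> generations.
\<close>

primrec height_pgf :: "complex \<Rightarrow> nat \<Rightarrow> real \<Rightarrow> complex" where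
  "height_pgf z 0 = (\<lambda>_. 0)"
| "height_pgf z (Suc k) = (\<lambda>a. z * poisson_functional (height_pgf z k) a)"

lemma height_pgf:
  assumes z: "norm z \<le> 1"
  shows "height_pgf z k \<in> borel_measurable borel \<and> (\<forall>a. norm (height_pgf z k a) \<le> 1)"
proof (induction k)
  case (Suc k)
  then have m: "height_pgf z k \<in> borel_measurable borel" and b: "\<And>a. norm (height_pgf z k a) \<le> 1"
    by auto
  have "norm (z * poisson_functional (height_pgf z k) a) \<le> 1" for a
    unfolding norm_mult using z norm_poisson_functional_le_1[OF m b]
    by (intro mult_le_one) auto
  then show ?case using measurable_poisson_functional[OF m b] by simp
qed simp

lemmas measurable_height_pgf = height_pgf[THEN conjunct1]
lemmas norm_height_pgf_le_1 = height_pgf[THEN conjunct2, rule_format]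

end

context GW_tree
begin

lemma size_root_children: "size (children_ages (H \<omega>) []) = root_degree (H \<omega>)"
  by (simp add: children_ages_def root_degree_def)

lemma measurable_root_degree: "(\<lambda>\<omega>. root_degree (H \<omega>)) \<in> measurable M (count_space UNIV)"
  using measurable_offspring_count[OF tree measurable_H, of UNIV "[]"] by (simp add: size_root_children)

text \<open>
  The rate is bounded by \<open>C\<close>, whence Poisson-type tails.
\<close>

lemma prob_root_degree_le: "prob {\<omega> \<in> space M. root_degree (H \<omega>) = k} \<le> C ^ k / fact k"
proof -
  let ?E = "{\<omega> \<in> space M. root_degree (H \<omega>) = k}"
  let ?r = "rate [] UNIV"
  have p: "0 \<le> poisson_prob (?r \<omega>) k" "poisson_prob (?r \<omega>) k \<le> C ^ k / fact k" for \<omega>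
  proof -
    have "exp (- ?r \<omega>) * ?r \<omega> ^ k \<le> 1 * C ^ k"
      by (intro mult_mono power_mono rate_le) (auto simp: rate_nonneg)
    then show "poisson_prob (?r \<omega>) k \<le> C ^ k / fact k"
      by (simp add: poisson_prob_def divide_right_mono)
  qed (simp add: poisson_prob_def rate_nonneg)
  have I: "{[] :: nat list} \<times> {..<1::nat} = {([], 0)}" by auto
  have [measurable]: "?E \<in> sets M"
    using measurable_sets[OF measurable_root_degree, of "{k}"] by (simp add: vimage_def Int_def conj_commute)
  have "(\<integral>\<omega>. complex_of_real (indicator ?E \<omega>) \<partial>M) = (\<integral>\<omega>. complex_of_real (poisson_prob (?r \<omega>) k) \<partial>M)"
  proof -
    have disj: "disjoint_family_on (\<lambda>_. UNIV :: real set) {..<1::nat}"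
      by (simp add: disjoint_family_on_def)
    have "finite {[] :: nat list}" "{[] :: nat list} \<subseteq> {v. length v = 0}" "integrable M (\<lambda>_. 1 :: complex)"
        "(\<lambda>_. 1 :: complex) \<in> borel_measurable (past 0)" by auto
    from integral_offspring_counts(3)[OF this(1,2) _ disj this(4,3), of "\<lambda>_. k"]
    show ?thesis unfolding I by (simp add: size_root_children)
  qed
  then have "(\<integral>\<omega>. indicator ?E \<omega> \<partial>M) = (\<integral>\<omega>. poisson_prob (?r \<omega>) k \<partial>M)"
    unfolding integral_complex_of_real of_real_eq_iff .
  then have "prob ?E = (\<integral>\<omega>. poisson_prob (?r \<omega>) k \<partial>M)"
    by (simp add: Int_absorb2 Collect_mono_iff)
  also have "\<dots> \<le> (\<integral>\<omega>. C ^ k / fact k \<partial>M)"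
    by (rule integral_mono_AE') (use p C_nonneg in auto)
  finally show ?thesis by (simp add: prob_space)
qed

lemma integrable_power_root_degree:
  fixes R :: real
  assumes R: "0 \<le> R" shows "integrable M (\<lambda>\<omega>. R ^ root_degree (H \<omega>))"
proof (rule integrableI_bounded)
  let ?E = "\<lambda>k. {\<omega> \<in> space M. root_degree (H \<omega>) = k}"
  have E: "?E k \<in> sets M" for k
    using measurable_sets[OF measurable_root_degree, of "{k}"] by (simp add: vimage_def Int_def conj_commute)
  show "(\<lambda>\<omega>. R ^ root_degree (H \<omega>)) \<in> borel_measurable M"
    by (rule measurable_compose[OF measurable_root_degree]) simp
  have "(\<integral>\<^sup>+\<omega>. ennreal (norm (R ^ root_degree (H \<omega>))) \<partial>M) =
      (\<integral>\<^sup>+\<omega>. (\<Sum>k. ennreal (R ^ k) * indicator (?E k) \<omega>) \<partial>M)"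
  proof (rule nn_integral_cong)
    fix \<omega> assume "\<omega> \<in> space M"
    then have "(\<Sum>k. ennreal (R ^ k) * indicator (?E k) \<omega>) =
        (\<Sum>k. if k = root_degree (H \<omega>) then ennreal (R ^ k) else 0)"
      by (intro suminf_cong) auto
    also have "\<dots> = ennreal (R ^ root_degree (H \<omega>))"
      using suminf_finite[of "{root_degree (H \<omega>)}" "\<lambda>k. if k = root_degree (H \<omega>) then ennreal (R ^ k) else 0"]
      by simp
    finally show "ennreal (norm (R ^ root_degree (H \<omega>))) = (\<Sum>k. ennreal (R ^ k) * indicator (?E k) \<omega>)"
      using R by simp
  qed
  also have "\<dots> = (\<Sum>k. \<integral>\<^sup>+\<omega>. ennreal (R ^ k) * indicator (?E k) \<omega> \<partial>M)"
    using E by (intro nn_integral_suminf) auto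
  also have "\<dots> = (\<Sum>k. ennreal (R ^ k * prob (?E k)))"
    using E R by (simp add: nn_integral_cmult_indicator emeasure_eq_measure ennreal_mult)
  also have "\<dots> \<le> (\<Sum>k. ennreal ((R * C) ^ k /\<^sub>R fact k))"
  proof (intro suminf_le ennreal_leI)
    show "R ^ k * prob (?E k) \<le> (R * C) ^ k /\<^sub>R fact k" for k
      using mult_left_mono[OF prob_root_degree_le[of k], of "R ^ k"] R
      by (simp add: power_mult_distrib divide_inverse mult_ac)
  qed auto
  also have "\<dots> = ennreal (\<Sum>k. (R * C) ^ k /\<^sub>R fact k)"
    using R C_nonneg by (intro suminf_ennreal2 summable_exp_generic) auto
  also have "\<dots> < \<infinity>" by (rule ennreal_less_top[unfolded infinity_ennreal_def[symmetric]])
  finally show "(\<integral>\<^sup>+\<omega>. ennreal (norm (R ^ root_degree (H \<omega>))) \<partial>M) < \<infinity>" .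
qed

lemma vertex_weight_root:
  assumes "\<omega> \<in> space M" shows "vertex_weight f [] \<omega> = f (root_age (H \<omega>))"
  using is_aged_tree_root[OF tree[OF assms]] by (auto simp: vertex_weight_def root_age_def)

lemma measurable_root_age: "(\<lambda>\<omega>. root_age (H \<omega>)) \<in> borel_measurable (past 0)"
proof -
  have "(\<lambda>\<omega>. case H \<omega> [] of None \<Rightarrow> 0 | Some a \<Rightarrow> a) \<in> borel_measurable (past 0)"
    by (rule measurable_upto_vertex_age) auto
  moreover have "(case H \<omega> [] of None \<Rightarrow> 0 | Some a \<Rightarrow> a) = root_age (H \<omega>)" if "\<omega> \<in> space M" for \<omega>
    using is_aged_tree_root[OF tree[OF that]] by (auto simp: root_age_def)
  ultimately show ?thesis
    by (subst measurable_cong[where g="\<lambda>\<omega>. case H \<omega> [] of None \<Rightarrow> 0 | Some a \<Rightarrow> a"]) auto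
qed

lemma root_age_nonneg: "\<omega> \<in> space M \<Longrightarrow> 0 \<le> root_age (H \<omega>)"
  using is_aged_tree_age_nonneg[OF tree] is_aged_tree_root[OF tree] by (force simp: root_age_def)

lemma measurable_past_generation_prod:
  "i \<le> n \<Longrightarrow> f \<in> borel_measurable borel \<Longrightarrow>
     (\<lambda>\<omega>. generation_prod f i (H \<omega>)) \<in> borel_measurable (past n)"
  by (rule measurable_upto_generation_prod) auto

text \<open>
  Generation \<open>n + 1\<close> is integrated out by \<open>generation_generating_functional\<close>. The resulting Poisson
  functionals at the vertices of generation \<open>n\<close> combine with the factors \<open>z\<close> of these vertices to the
  next iterate, so \<open>n\<close> drops by one and \<open>k\<close> grows by one. In the last step, at the root, the factor
  \<open>s\<close> is absorbed into the function on the first generation, which may leave the unit disc; there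
  the exponential moments of the root degree provide the domination.
\<close>

lemma height_generating_function:
  assumes z: "norm z \<le> 1" and Y: "Y \<in> borel_measurable (past 0)" "\<And>\<omega>. norm (Y \<omega>) \<le> 1"
  shows "(\<integral>\<omega>. Y \<omega> * generation_prod (\<lambda>_. s) 1 (H \<omega>) * (\<Prod>i\<le>n. generation_prod (\<lambda>_. z) i (H \<omega>)) *
            generation_prod (height_pgf z k) (Suc n) (H \<omega>) \<partial>M) =
         (\<integral>\<omega>. Y \<omega> * (z * poisson_functional (\<lambda>x. s * height_pgf z (n + k) x) (root_age (H \<omega>))) \<partial>M)"
proof (induction n arbitrary: k)
  case 0
  let ?R = "max 1 (norm s)"
  let ?f = "\<lambda>x. s * height_pgf z k x"
  have Ym: "Y \<in> borel_measurable M" using Y(1) by (rule measurable_past)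
  have f: "?f \<in> borel_measurable borel" "\<And>x. norm (?f x) \<le> ?R"
    using mult_mono[OF _ norm_height_pgf_le_1[OF z], of "norm s" ?R k] measurable_height_pgf[OF z]
    by (auto simp: norm_mult)
  have Yz: "norm (Y \<omega> * z) \<le> 1" for \<omega>
    unfolding norm_mult using Y(2) z by (intro mult_le_one) auto
  have "(\<integral>\<omega>. Y \<omega> * generation_prod (\<lambda>_. s) 1 (H \<omega>) * (\<Prod>i\<le>0. generation_prod (\<lambda>_. z) i (H \<omega>)) *
            generation_prod (height_pgf z k) (Suc 0) (H \<omega>) \<partial>M) =
        (\<integral>\<omega>. (Y \<omega> * z) * (\<Prod>v\<in>{[]}. offspring_prod ?f (H \<omega>) v) \<partial>M)"
  proof (rule Bochner_Integration.integral_cong)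
    fix \<omega> assume "\<omega> \<in> space M"
    then have t: "is_aged_tree (H \<omega>)" by simp
    have "offspring_prod ?f (H \<omega>) [] = generation_prod ?f (Suc 0) (H \<omega>)"
      by (simp add: generation_prod_Suc[OF t] generation_0[OF t])
    then show "Y \<omega> * generation_prod (\<lambda>_. s) 1 (H \<omega>) * (\<Prod>i\<le>0. generation_prod (\<lambda>_. z) i (H \<omega>)) *
            generation_prod (height_pgf z k) (Suc 0) (H \<omega>) =
        (Y \<omega> * z) * (\<Prod>v\<in>{[]}. offspring_prod ?f (H \<omega>) v)"
      by (simp add: generation_prod_mult generation_prod_const generation_0[OF t])
  qed simp
  also have "\<dots> = (\<integral>\<omega>. (Y \<omega> * z) * (\<Prod>v\<in>{[]}. vertex_weight (poisson_functional ?f) v \<omega>) \<partial>M)"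
  proof (rule finite_generating_functional[OF _ _ f])
    show "(\<lambda>\<omega>. Y \<omega> * z) \<in> borel_measurable (past 0)" using Y(1) by simp
    show "integrable M (\<lambda>\<omega>. Y \<omega> * z)"
      using Yz Ym by (intro integrable_const_bound[where B=1]) auto
    show "integrable M (\<lambda>\<omega>. norm (Y \<omega> * z) * (\<Prod>v\<in>{[]}. ?R ^ size (children_ages (H \<omega>) v)))"
    proof (rule Bochner_Integration.integrable_bound[OF integrable_power_root_degree[of ?R]])
      show "(\<lambda>\<omega>. norm (Y \<omega> * z) * (\<Prod>v\<in>{[]}. ?R ^ size (children_ages (H \<omega>) v))) \<in> borel_measurable M"
        using Ym measurable_compose[OF measurable_root_degree, of "\<lambda>k. ?R ^ k"]
        by (auto simp: size_root_children)
      show "AE \<omega> in M. norm (norm (Y \<omega> * z) * (\<Prod>v\<in>{[]}. ?R ^ size (children_ages (H \<omega>) v))) \<le>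
          norm (?R ^ root_degree (H \<omega>))"
        using Yz by (intro AE_I2) (simp add: size_root_children abs_mult mult_left_le_one_le)
    qed simp
  qed auto
  also have "\<dots> = (\<integral>\<omega>. Y \<omega> * (z * poisson_functional ?f (root_age (H \<omega>))) \<partial>M)"
    by (intro Bochner_Integration.integral_cong) (simp_all add: vertex_weight_root)
  finally show ?case by simp
next
  case (Suc n)
  let ?Y = "\<lambda>\<omega>. Y \<omega> * generation_prod (\<lambda>_. s) 1 (H \<omega>) * (\<Prod>i\<le>Suc n. generation_prod (\<lambda>_. z) i (H \<omega>))"
  have Ym: "?Y \<in> borel_measurable (past (Suc n))"
    using measurable_past_mono[OF _ Y(1)]
    by (intro borel_measurable_times borel_measurable_prod measurable_past_generation_prod) auto
  have "norm (\<Prod>i\<le>Suc n. generation_prod (\<lambda>_. z) i (H \<omega>)) \<le> 1" for \<omega>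
    unfolding prod_norm[symmetric]
    using norm_generation_prod_le_1[of "\<lambda>_. z"] z by (intro prod_le_1) auto
  then have le: "norm (?Y \<omega>) \<le> norm s ^ root_degree (H \<omega>)" if "\<omega> \<in> space M" for \<omega>
    using Y(2) that root_degree_eq[OF tree[OF that]]
    by (simp add: norm_mult generation_prod_const norm_power mult_le_one
        mult_left_le mult_left_le_one_le mult.commute[of "norm (Y \<omega>)"] mult.assoc del: prod.atMost_Suc)
  have "integrable M ?Y"
  proof (rule Bochner_Integration.integrable_bound[OF integrable_power_root_degree[of "norm s"]])
    show "?Y \<in> borel_measurable M" using Ym by (rule measurable_past)
  qed (use le in auto)
  then have "(\<integral>\<omega>. ?Y \<omega> * generation_prod (height_pgf z k) (Suc (Suc n)) (H \<omega>) \<partial>M) =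
      (\<integral>\<omega>. ?Y \<omega> * generation_prod (poisson_functional (height_pgf z k)) (Suc n) (H \<omega>) \<partial>M)"
    by (intro generation_generating_functional measurable_height_pgf norm_height_pgf_le_1 z Ym)
  also have "\<dots> = (\<integral>\<omega>. Y \<omega> * generation_prod (\<lambda>_. s) 1 (H \<omega>) * (\<Prod>i\<le>n. generation_prod (\<lambda>_. z) i (H \<omega>)) *
            generation_prod (height_pgf z (Suc k)) (Suc n) (H \<omega>) \<partial>M)"
    by (simp add: generation_prod_mult mult.assoc)
  also have "\<dots> = (\<integral>\<omega>. Y \<omega> * (z * poisson_functional (\<lambda>x. s * height_pgf z (n + Suc k) x) (root_age (H \<omega>))) \<partial>M)"
    by (rule Suc.IH)
  finally show ?case by simp
qed

text \<open>
  For \<open>k = 0\<close>, \<open>height_generating_function\<close> concerns the trees without vertices in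
  generation \<open>n + 1\<close>. Letting \<open>n\<close> tend to infinity captures all finite trees.
\<close>

theorem total_progeny_generating_function:
  assumes z: "norm z \<le> 1"
    and F: "F \<in> borel_measurable borel" "\<And>x. norm (F x) \<le> 1"
    and lim: "\<And>a. 0 \<le> a \<Longrightarrow> AE x in \<Lambda> a. (\<lambda>k. height_pgf z k x) \<longlonglongrightarrow> F x"
    and Y: "Y \<in> borel_measurable (past 0)" "\<And>\<omega>. norm (Y \<omega>) \<le> 1"
  shows "integrable M (\<lambda>\<omega>. power_size z (H \<omega>) * s ^ root_degree (H \<omega>))"
    and "(\<integral>\<omega>. Y \<omega> * (power_size z (H \<omega>) * s ^ root_degree (H \<omega>)) \<partial>M) =
         (\<integral>\<omega>. Y \<omega> * (z * poisson_functional (\<lambda>x. s * F x) (root_age (H \<omega>))) \<partial>M)"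
proof -
  have Ym: "Y \<in> borel_measurable M" using Y(1) by (rule measurable_past)
  define V where "V n \<omega> = (\<Prod>i\<le>n. generation_prod (\<lambda>_. z) i (H \<omega>)) *
      generation_prod (height_pgf z 0) (Suc n) (H \<omega>)" for n \<omega>
  have V_lim: "(\<lambda>n. V n \<omega>) \<longlonglongrightarrow> power_size z (H \<omega>)" if "\<omega> \<in> space M" for \<omega>
    using power_size_tendsto[OF tree[OF that], of z] by (simp add: V_def generation_prod_const)
  have V_le: "norm (V n \<omega>) \<le> 1" for n \<omega>
  proof -
    have "norm (\<Prod>i\<le>n. generation_prod (\<lambda>_. z) i (H \<omega>)) \<le> 1"
      unfolding prod_norm[symmetric]
      using norm_generation_prod_le_1[of "\<lambda>_. z"] z by (intro prod_le_1) auto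
    moreover have "norm (generation_prod (height_pgf z 0) (Suc n) (H \<omega>)) \<le> 1"
      by (rule norm_generation_prod_le_1) simp
    ultimately show ?thesis unfolding V_def norm_mult by (intro mult_le_one norm_ge_zero)
  qed
  have gen: "(\<lambda>\<omega>. generation_prod h k (H \<omega>)) \<in> borel_measurable M"
    if "h \<in> borel_measurable borel" for h k
    using that by (intro measurable_past[of _ k] measurable_upto_generation_prod) auto
  have V_meas: "V n \<in> borel_measurable M" for n
    unfolding V_def by (intro borel_measurable_times borel_measurable_prod gen) auto
  have p_meas: "(\<lambda>\<omega>. power_size z (H \<omega>)) \<in> borel_measurable M"
    by (rule borel_measurable_LIMSEQ_metric[OF V_meas V_lim])
  have d_meas: "(\<lambda>\<omega>. s ^ root_degree (H \<omega>)) \<in> borel_measurable M"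
    by (rule measurable_compose[OF measurable_root_degree]) simp
  have p_le: "norm (power_size z (H \<omega>)) \<le> 1" if "\<omega> \<in> space M" for \<omega>
    by (rule tendsto_upperbound[OF tendsto_norm[OF V_lim[OF that]]]) (simp_all add: V_le)
  note dom = integrable_power_root_degree[OF norm_ge_zero[of s]]
  show "integrable M (\<lambda>\<omega>. power_size z (H \<omega>) * s ^ root_degree (H \<omega>))"
    by (rule Bochner_Integration.integrable_bound[OF dom])
      (use p_meas d_meas p_le in \<open>auto simp: norm_mult norm_power mult_left_le_one_le\<close>)

  have "(\<lambda>n. \<integral>\<omega>. Y \<omega> * (V n \<omega> * s ^ root_degree (H \<omega>)) \<partial>M) \<longlonglongrightarrow>
      (\<integral>\<omega>. Y \<omega> * (power_size z (H \<omega>) * s ^ root_degree (H \<omega>)) \<partial>M)"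
  proof (rule integral_dominated_convergence[OF _ _ dom])
    show "AE \<omega> in M. norm (Y \<omega> * (V n \<omega> * s ^ root_degree (H \<omega>))) \<le> norm s ^ root_degree (H \<omega>)" for n
    proof (intro AE_I2)
      fix \<omega>
      have "norm (Y \<omega>) * norm (V n \<omega>) \<le> 1" by (intro mult_le_one norm_ge_zero Y(2) V_le)
      then have "(norm (Y \<omega>) * norm (V n \<omega>)) * norm s ^ root_degree (H \<omega>) \<le> norm s ^ root_degree (H \<omega>)"
        by (intro mult_left_le_one_le) auto
      then show "norm (Y \<omega> * (V n \<omega> * s ^ root_degree (H \<omega>))) \<le> norm s ^ root_degree (H \<omega>)"
        by (simp add: norm_mult norm_power mult.assoc)
    qed
    show "AE \<omega> in M. (\<lambda>n. Y \<omega> * (V n \<omega> * s ^ root_degree (H \<omega>))) \<longlonglongrightarrow>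
        Y \<omega> * (power_size z (H \<omega>) * s ^ root_degree (H \<omega>))"
      by (intro AE_I2 tendsto_intros V_lim)
  qed (use Ym V_meas p_meas d_meas in auto)
  moreover have "(\<integral>\<omega>. Y \<omega> * (V n \<omega> * s ^ root_degree (H \<omega>)) \<partial>M) =
      (\<integral>\<omega>. Y \<omega> * (z * poisson_functional (\<lambda>x. s * height_pgf z n x) (root_age (H \<omega>))) \<partial>M)" for n
    unfolding height_generating_function[OF z Y, of s n 0, simplified, symmetric] V_def
    by (intro Bochner_Integration.integral_cong)
      (simp_all add: generation_prod_const root_degree_eq mult_ac)
  moreover have "(\<lambda>n. \<integral>\<omega>. Y \<omega> * (z * poisson_functional (\<lambda>x. s * height_pgf z n x) (root_age (H \<omega>))) \<partial>M)
      \<longlonglongrightarrow> (\<integral>\<omega>. Y \<omega> * (z * poisson_functional (\<lambda>x. s * F x) (root_age (H \<omega>))) \<partial>M)"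
  proof (rule integral_dominated_convergence[where w="\<lambda>_. exp ((norm s + 1) * C)"])
    have h: "(\<lambda>x. s * height_pgf z n x) \<in> borel_measurable borel"
        "norm (s * height_pgf z n x) \<le> norm s" for n x
      using measurable_height_pgf[OF z] norm_height_pgf_le_1[OF z] by (auto simp: norm_mult mult_left_le)
    have sF: "(\<lambda>x. s * F x) \<in> borel_measurable borel" "norm (s * F x) \<le> norm s" for x
      using F by (auto simp: norm_mult mult_left_le)
    have age: "(\<lambda>\<omega>. root_age (H \<omega>)) \<in> borel_measurable M"
      using measurable_root_age by (rule measurable_past)
    show "(\<lambda>\<omega>. Y \<omega> * (z * poisson_functional (\<lambda>x. s * height_pgf z n x) (root_age (H \<omega>)))) \<in> borel_measurable M" for n
      using measurable_compose[OF age measurable_poisson_functional[OF h]] Ym by auto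
    show "(\<lambda>\<omega>. Y \<omega> * (z * poisson_functional (\<lambda>x. s * F x) (root_age (H \<omega>)))) \<in> borel_measurable M"
      using measurable_compose[OF age measurable_poisson_functional[OF sF]] Ym by auto
    show "AE \<omega> in M. (\<lambda>n. Y \<omega> * (z * poisson_functional (\<lambda>x. s * height_pgf z n x) (root_age (H \<omega>))))
        \<longlonglongrightarrow> Y \<omega> * (z * poisson_functional (\<lambda>x. s * F x) (root_age (H \<omega>)))"
    proof (rule AE_I2, intro tendsto_mult tendsto_const tendsto_poisson_functional[OF h(1) sF(1) h(2)])
      fix \<omega> assume "\<omega> \<in> space M"
      from lim[OF root_age_nonneg[OF this]]
      show "AE x in \<Lambda> (root_age (H \<omega>)). (\<lambda>n. s * height_pgf z n x) \<longlonglongrightarrow> s * F x"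
        by eventually_elim (intro tendsto_intros)
    qed
    show "AE \<omega> in M. norm (Y \<omega> * (z * poisson_functional (\<lambda>x. s * height_pgf z n x) (root_age (H \<omega>))))
        \<le> exp ((norm s + 1) * C)" for n
    proof (intro AE_I2)
      fix \<omega>
      have "norm (Y \<omega> * z) * norm (poisson_functional (\<lambda>x. s * height_pgf z n x) (root_age (H \<omega>)))
          \<le> 1 * exp ((norm s + 1) * C)"
        using Y(2)[of \<omega>] z norm_poisson_functional_le[OF h]
        by (intro mult_mono) (auto simp: norm_mult mult_le_one)
      then show "norm (Y \<omega> * (z * poisson_functional (\<lambda>x. s * height_pgf z n x) (root_age (H \<omega>))))
        \<le> exp ((norm s + 1) * C)" by (simp add: norm_mult mult.assoc)
    qed
  qed auto
  ultimately show "(\<integral>\<omega>. Y \<omega> * (power_size z (H \<omega>) * s ^ root_degree (H \<omega>)) \<partial>M) =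
         (\<integral>\<omega>. Y \<omega> * (z * poisson_functional (\<lambda>x. s * F x) (root_age (H \<omega>))) \<partial>M)"
    using LIMSEQ_unique by simp
qed

end

section \<open>The offspring intensity\<close>

definition age_density :: "real \<Rightarrow> real" where
  "age_density y = (1 - (tanh (y / 2))\<^sup>2) / 2"

lemma age_density_eq: "1/2 * (sech (y / 2))\<^sup>2 = age_density y"
proof -
  have "(1 / c)\<^sup>2 = 1 - (s / c)\<^sup>2" if "c\<^sup>2 = s\<^sup>2 + 1" "c \<noteq> 0" for c s :: real
  proof -
    have "1 - (s / c)\<^sup>2 = (c\<^sup>2 - s\<^sup>2) / c\<^sup>2"
      using that(2) by (simp add: power_divide diff_divide_distrib)
    then show ?thesis by (simp add: that(1) power_divide)
  qed
  from this[OF cosh_square_eq] have "(sech (y / 2))\<^sup>2 = 1 - (tanh (y / 2))\<^sup>2"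
    by (simp add: sech_def tanh_def)
  then show ?thesis by (simp add: age_density_def)
qed

lemma age_density_nonneg: "0 \<le> age_density y"
  by (simp add: age_density_eq[symmetric])

lemma tanh_half_derivative:
  "((\<lambda>y. tanh (y / 2)) has_real_derivative age_density y) (at y)"
  unfolding age_density_def by (auto intro!: derivative_eq_intros)

lemma isCont_tanh_half [continuous_intros]: "isCont (\<lambda>y::real. tanh (y / 2)) y"
  using tanh_half_derivative by (rule DERIV_isCont)

lemma isCont_age_density: "isCont age_density y"
  unfolding age_density_def[abs_def] by (intro continuous_intros isCont_tanh_half) auto

lemma measurable_tanh_half [measurable]: "(\<lambda>y::real. tanh (y / 2)) \<in> borel_measurable borel"
  by (intro borel_measurable_continuous_onI continuous_at_imp_continuous_on ballI isCont_tanh_half)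

lemma measurable_age_density [measurable]: "age_density \<in> borel_measurable borel"
  unfolding age_density_def[abs_def] by measurable

lemma tanh_half_at_top: "((\<lambda>y::real. tanh (y / 2)) \<longlongrightarrow> 1) at_top"
  using filterlim_compose[OF tanh_real_at_top
      filterlim_tendsto_pos_mult_at_top[OF tendsto_const _ filterlim_ident, of "1 / 2"]]
  by simp

lemma nn_integral_age_density: "(\<integral>\<^sup>+y. ennreal (age_density y) * indicator {0..} y \<partial>lborel) = 1"
  using nn_integral_FTC_atLeast[OF measurable_age_density tanh_half_derivative age_density_nonneg
      tanh_half_at_top, of 0] by simp

lemma integrable_age_density: "integrable lborel (\<lambda>y. indicator {0..} y * age_density y)"
proof (rule integrableI_nonneg)
  have "(\<integral>\<^sup>+y. ennreal (indicator {0..} y * age_density y) \<partial>lborel) =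
      (\<integral>\<^sup>+y. ennreal (age_density y) * indicator {0..} y \<partial>lborel)"
    by (intro nn_integral_cong) (simp add: indicator_def)
  then show "(\<integral>\<^sup>+y. ennreal (indicator {0..} y * age_density y) \<partial>lborel) < \<infinity>"
    by (simp add: nn_integral_age_density)
qed (auto simp: age_density_nonneg)

definition offspring_density :: "real \<Rightarrow> real \<Rightarrow> real" where
  "offspring_density a y = indicator {0..} y * age_density y * max 0 (min y a)"

lemma offspring_density_nonneg: "0 \<le> offspring_density a y"
  by (simp add: offspring_density_def age_density_nonneg)

lemma measurable_offspring_density [measurable]:
  "(\<lambda>(a, y). offspring_density a y) \<in> borel_measurable (borel \<Otimes>\<^sub>M borel)"
  unfolding offspring_density_def by measurable

lemma offspring_intensity_eq:
  "offspring_intensity a = density lborel (\<lambda>y. ennreal (offspring_density a y))"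
proof -
  have "ennreal (indicator {0..} y * age_density y) * ennreal (min y a) = ennreal (offspring_density a y)" for y
    unfolding offspring_density_def
    by (subst (2) ennreal_mult) (auto simp: age_density_nonneg max_def ennreal_neg)
  then show ?thesis
    unfolding offspring_intensity_def age_law_def age_density_eq
    by (subst density_density_eq) auto
qed

lemma sets_offspring_intensity: "sets (offspring_intensity a) = sets borel"
  by (simp add: offspring_intensity_eq)

lemma space_offspring_intensity: "space (offspring_intensity a) = UNIV"
  by (simp add: offspring_intensity_eq)

lemma integrable_offspring_density: "integrable lborel (offspring_density a)"
proof (rule Bochner_Integration.integrable_bound[OF integrable_mult_left[OF integrable_age_density, of "\<bar>a\<bar>"]])
  have "indicator {0..} y * age_density y * max 0 (min y a) \<le> indicator {0..} y * age_density y * \<bar>a\<bar>" for y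
    by (intro mult_left_mono) (auto simp: age_density_nonneg)
  then show "AE y in lborel. norm (offspring_density a y) \<le> norm (indicator {0..} y * age_density y * \<bar>a\<bar>)"
    using offspring_density_nonneg[of a]
    by (intro AE_I2) (simp add: offspring_density_def abs_mult age_density_nonneg)
qed simp

lemma finite_measure_offspring_intensity: "finite_measure (offspring_intensity a)"
proof (rule finite_measureI)
  have "emeasure (offspring_intensity a) UNIV = (\<integral>\<^sup>+y. ennreal (offspring_density a y) \<partial>lborel)"
    unfolding offspring_intensity_eq by (subst emeasure_density) auto
  also have "\<dots> = ennreal (\<integral>y. offspring_density a y \<partial>lborel)"
    by (rule nn_integral_eq_integral[OF integrable_offspring_density]) (simp add: offspring_density_nonneg)
  finally show "emeasure (offspring_intensity a) (space (offspring_intensity a)) \<noteq> \<infinity>"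
    by (simp add: space_offspring_intensity)
qed

lemma integral_offspring_intensity_density:
  fixes f :: "real \<Rightarrow> 'a::{banach, second_countable_topology}"
  assumes "f \<in> borel_measurable borel"
  shows "(\<integral>y. f y \<partial>offspring_intensity a) = (\<integral>y. offspring_density a y *\<^sub>R f y \<partial>lborel)"
  unfolding offspring_intensity_eq
  using assms by (intro integral_density) (auto simp: offspring_density_nonneg)

lemma AE_offspring_intensity_nonneg: "AE y in offspring_intensity a. 0 \<le> y"
  unfolding offspring_intensity_eq
  by (subst AE_density) (auto simp: offspring_density_def indicator_def)

lemma measurable_measure_offspring_intensity:
  assumes [measurable]: "B \<in> sets borel"
  shows "(\<lambda>a. measure (offspring_intensity a) B) \<in> borel_measurable borel"
proof -
  have "measure (offspring_intensity a) B = (\<integral>y. offspring_density a y *\<^sub>R indicator B y \<partial>lborel)" for a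
    by (subst integral_offspring_intensity_density[symmetric])
      (use assms in \<open>auto simp: space_offspring_intensity\<close>)
  moreover have "(\<lambda>a. \<integral>y. offspring_density a y *\<^sub>R (indicator B y :: real) \<partial>lborel) \<in> borel_measurable borel"
    by measurable
  ultimately show ?thesis by simp
qed

text \<open>
  Integration by parts with the kernel \<open>min(x,y)\<close>: the function \<open>y \<mapsto> h(min(x,y)) - min(x,y) q(y)\<close> is an
  antiderivative of \<open>y \<mapsto> f(y) min(x,y) age_density(y)\<close>. It is differentiable even at \<open>y = x\<close>, where the
  two one-sided derivatives agree.
\<close>

lemma integral_offspring_intensity:
  fixes f h q :: "real \<Rightarrow> 'a::euclidean_space"
  assumes x: "0 \<le> x" and f: "f \<in> borel_measurable borel" "\<And>y. norm (f y) \<le> K" "\<And>y. 0 < y \<Longrightarrow> isCont f y"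
    and h: "\<And>y. 0 \<le> y \<Longrightarrow> (h has_vector_derivative q y) (at y)"
    and q: "\<And>y. 0 \<le> y \<Longrightarrow> (q has_vector_derivative - (age_density y *\<^sub>R f y)) (at y)" "(q \<longlongrightarrow> 0) at_top"
  shows "(\<integral>y. f y \<partial>offspring_intensity x) = h x - h 0"
proof -
  define A where "A y = h (min y x) - min y x *\<^sub>R q y" for y
  define g where "g y = (age_density y * min y x) *\<^sub>R f y" for y
  \<comment> \<open>At the point 0, where the two indicators differ, \<open>min(x,y)\<close> vanishes.\<close>
  have g_eq: "offspring_density x y *\<^sub>R f y = indicator {0<..} y *\<^sub>R g y" for y
    using x by (auto simp: offspring_density_def g_def indicator_def)
  have deriv: "(A has_vector_derivative g y) (at y)" if "0 < y" for y
  proof -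
    have A_if: "A = (\<lambda>y. if y \<in> {..x} then h y - y *\<^sub>R q y else h x - x *\<^sub>R q y)"
      by (auto simp: A_def fun_eq_iff min_def)
    have "((\<lambda>y. h y - y *\<^sub>R q y) has_vector_derivative
        q y - (y *\<^sub>R - (age_density y *\<^sub>R f y) + 1 *\<^sub>R q y)) (at y)"
      using that by (intro has_vector_derivative_diff has_vector_derivative_scaleR h q(1) DERIV_ident) auto
    then have left: "((\<lambda>y. h y - y *\<^sub>R q y) has_vector_derivative (age_density y * y) *\<^sub>R f y) (at y)"
      by (simp add: mult.commute)
    have "((\<lambda>y. h x - x *\<^sub>R q y) has_vector_derivative
        0 - (x *\<^sub>R - (age_density y *\<^sub>R f y) + 0 *\<^sub>R q y)) (at y)"
      using that by (intro has_vector_derivative_diff has_vector_derivative_scaleR q(1) DERIV_const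
          has_vector_derivative_const) auto
    then have right: "((\<lambda>y. h x - x *\<^sub>R q y) has_vector_derivative (age_density y * x) *\<^sub>R f y) (at y)"
      by (simp add: mult.commute)
    have "(A has_vector_derivative
        (if y \<in> {..x} then (age_density y * y) *\<^sub>R f y else (age_density y * x) *\<^sub>R f y)) (at y within UNIV)"
      unfolding A_if
      by (rule has_vector_derivative_If_within_closures[where S="{..x}" and T="{x<..}"])
        (auto intro!: has_vector_derivative_at_within left right)
    then show ?thesis by (auto simp: g_def min_def split: if_splits)
  qed
  have int: "integrable lborel (\<lambda>y. offspring_density x y *\<^sub>R f y)"
  proof (rule Bochner_Integration.integrable_bound[OF integrable_mult_left[OF integrable_offspring_density[of x], of K]])
    show "(\<lambda>y. offspring_density x y *\<^sub>R f y) \<in> borel_measurable lborel" using f(1) by simp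
    have "0 \<le> K" using f(2)[of 0] norm_ge_zero[of "f 0"] by linarith
    then show "AE y in lborel. norm (offspring_density x y *\<^sub>R f y) \<le> norm (offspring_density x y * K)"
      using f(2) by (intro AE_I2) (simp add: abs_mult offspring_density_nonneg mult_left_mono)
  qed
  have cont_q: "isCont q y" and cont_h: "isCont h y" if "0 \<le> y" for y
    using h[OF that] q(1)[OF that] by (auto dest: has_vector_derivative_continuous)
  have "(LBINT y=ereal 0..\<infinity>. g y) = h x - h 0"
  proof (rule interval_integral_FTC_integrable)
    show "(A has_vector_derivative g y) (at y)" if "ereal 0 < ereal y" for y
      using that deriv by simp
    show "isCont g y" if "ereal 0 < ereal y" for y
      unfolding g_def using that
      by (intro continuous_intros isCont_age_density f(3)) auto
    show "set_integrable lborel (einterval (ereal 0) \<infinity>) g"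
      using int unfolding g_eq set_integrable_def by (simp add: einterval_def greaterThan_def)
    have min_0: "min 0 x = 0" using x by simp
    have cont_min: "isCont (\<lambda>y. min y x) 0" by (intro continuous_intros)
    have "isCont (\<lambda>y. h (min y x)) 0"
      using cont_h[of 0] by (intro isCont_o2[OF cont_min]) (simp add: min_0)
    then have "isCont A 0"
      unfolding A_def using cont_q[of 0] cont_min by (intro continuous_intros) auto
    then have "(A \<longlongrightarrow> A 0) (at_right 0)"
      unfolding isCont_def by (rule tendsto_within_subset) simp
    then show "((A \<circ> real_of_ereal) \<longlongrightarrow> h 0) (at_right (ereal 0))"
      using x by (simp add: ereal_tendsto_simps A_def del: zero_ereal_def)
    have "((\<lambda>y. h x - x *\<^sub>R q y) \<longlongrightarrow> h x - x *\<^sub>R 0) at_top"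
      by (intro tendsto_intros q(2))
    moreover have "eventually (\<lambda>y. h x - x *\<^sub>R q y = A y) at_top"
      using eventually_gt_at_top[of x] by eventually_elim (simp add: A_def)
    ultimately have "(A \<longlongrightarrow> h x) at_top"
      by (simp add: filterlim_cong)
    then show "((A \<circ> real_of_ereal) \<longlongrightarrow> h x) (at_left \<infinity>)"
      by (simp add: ereal_tendsto_simps)
  qed simp_all
  then show ?thesis
    unfolding integral_offspring_intensity_density[OF f(1)] g_eq
    by (simp add: interval_lebesgue_integral_def set_lebesgue_integral_def einterval_def greaterThan_def)
qed


lemma tanh_half_nonneg: "0 \<le> y \<Longrightarrow> 0 \<le> tanh (y / 2 :: real)"
  by simp

lemma tanh_half_vector_derivative:
  "((\<lambda>y. tanh (y / 2)) has_vector_derivative age_density y) (at y)"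
  using tanh_half_derivative by (simp add: has_real_derivative_iff_has_vector_derivative)

lemma complex_tanh_half_vector_derivative:
  "((\<lambda>y. complex_of_real (tanh (y / 2))) has_vector_derivative of_real (age_density y)) (at y)"
  using has_vector_derivative_of_real[OF tanh_half_derivative] .

text \<open>
  The tree is critical, and \<open>tanh (x / 2)\<close> is the eigenfunction for the eigenvalue \<open>1\<close>.
\<close>

lemma offspring_intensity_tanh:
  assumes "0 \<le> x"
  shows "(\<integral>y. tanh (y / 2) \<partial>offspring_intensity x) = tanh (x / 2)"
proof -
  have "(\<integral>y. tanh (y / 2) \<partial>offspring_intensity x) = tanh (x / 2) - tanh (0 / 2)"
  proof (rule integral_offspring_intensity[OF assms, where K=1 and q=age_density])
    show "norm (tanh (y / 2)) \<le> 1" for y :: real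
      using tanh_real_bounds[of "y / 2"] by auto
    show "(age_density has_vector_derivative - (age_density y *\<^sub>R tanh (y / 2))) (at y)" for y
      unfolding has_real_derivative_iff_has_vector_derivative[symmetric] age_density_def[abs_def]
      by (auto intro!: derivative_eq_intros simp: field_simps power2_eq_square)
    have "(age_density \<longlongrightarrow> (1 - 1\<^sup>2) / 2) at_top"
      unfolding age_density_def[abs_def] by (intro tendsto_intros tanh_half_at_top) auto
    then show "(age_density \<longlongrightarrow> 0) at_top" by simp
  qed (auto intro: isCont_tanh_half tanh_half_vector_derivative)
  then show ?thesis by simp
qed

lemma offspring_intensity_total:
  assumes "0 \<le> x"
  shows "measure (offspring_intensity x) UNIV = 2 * ln (1 + tanh (x / 2))"
proof -
  have "(\<integral>y. (1::real) \<partial>offspring_intensity x) = 2 * ln (1 + tanh (x / 2)) - 2 * ln (1 + tanh (0 / 2))"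
  proof (rule integral_offspring_intensity[OF assms, where K=1 and q="\<lambda>y. 1 - tanh (y / 2)"])
    fix y :: real assume "0 \<le> y"
    then have "0 < 1 + tanh (y / 2)" using tanh_half_nonneg[of y] by linarith
    then show "((\<lambda>y. 2 * ln (1 + tanh (y / 2))) has_vector_derivative 1 - tanh (y / 2)) (at y)"
      unfolding has_real_derivative_iff_has_vector_derivative[symmetric]
      by (auto intro!: derivative_eq_intros simp: field_simps power2_eq_square)
    show "((\<lambda>y. 1 - tanh (y / 2)) has_vector_derivative - (age_density y *\<^sub>R 1)) (at y)"
      unfolding has_real_derivative_iff_has_vector_derivative[symmetric]
      by (auto intro!: derivative_eq_intros simp: age_density_def)
  next
    have "((\<lambda>y::real. 1 - tanh (y / 2)) \<longlongrightarrow> 1 - 1) at_top"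
      by (intro tendsto_intros tanh_half_at_top)
    then show "((\<lambda>y::real. 1 - tanh (y / 2)) \<longlongrightarrow> 0) at_top" by simp
  qed auto
  then show ?thesis by (simp add: space_offspring_intensity)
qed

lemma offspring_intensity_total_le:
  assumes "0 \<le> x"
  shows "measure (offspring_intensity x) UNIV \<le> 2 * tanh (x / 2)"
  unfolding offspring_intensity_total[OF assms]
  using ln_add_one_self_le_self[OF tanh_half_nonneg[OF assms]] by simp

interpretation offspring: bounded_kernel offspring_intensity 2
proof (rule bounded_kernel.intro)
  show "measure (offspring_intensity a) UNIV \<le> 2" for a
  proof (cases "0 \<le> a")
    case True
    then show ?thesis using offspring_intensity_total_le[OF True] tanh_real_lt_1[of "a / 2"] by linarith
  next
    case False
    then have "offspring_density a y = 0" for y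
      by (auto simp: offspring_density_def indicator_def)
    then show ?thesis by (simp add: offspring_intensity_eq measure_def emeasure_density)
  qed
qed (simp_all add: finite_measure_offspring_intensity sets_offspring_intensity
    measurable_measure_offspring_intensity)

section \<open>The closed form\<close>

text \<open>
  The closed form \<open>z / (1 + tanh (y / 2) c)\<^sup>2\<close> with \<open>z = 1 - c\<^sup>2\<close>. The maximum freezes
  its value at negative ages, so that it is continuous and bounded on the whole real line if
  \<open>Re c \<ge> 0\<close>.
\<close>

definition progeny_pgf :: "complex \<Rightarrow> real \<Rightarrow> complex" where
  "progeny_pgf c y = (1 - c\<^sup>2) / (1 + of_real (tanh (max 0 y / 2)) * c)\<^sup>2"

lemma Re_one_plus_ge_1:
  fixes c :: complex
  assumes "0 \<le> Re c" "0 \<le> t" shows "1 \<le> Re (1 + of_real t * c)"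
  using assms by simp

lemma one_le_norm_one_plus:
  fixes c :: complex
  assumes "0 \<le> Re c" "0 \<le> t" shows "1 \<le> norm (1 + of_real t * c)"
  using Re_one_plus_ge_1[OF assms] complex_Re_le_cmod[of "1 + of_real t * c"] by linarith

lemma norm_progeny_pgf_le:
  assumes "0 \<le> Re c" shows "norm (progeny_pgf c y) \<le> norm (1 - c\<^sup>2)"
proof -
  have "1 \<le> norm (1 + of_real (tanh (max 0 y / 2)) * c)"
    using assms by (intro one_le_norm_one_plus) auto
  then have "1 \<le> norm (1 + of_real (tanh (max 0 y / 2)) * c) ^ 2" by (rule one_le_power)
  then show ?thesis unfolding progeny_pgf_def norm_divide norm_power
    by (simp add: divide_le_eq mult_le_cancel_left1)
qed

lemma isCont_progeny_pgf:
  assumes "0 \<le> Re c" shows "isCont (progeny_pgf c) y"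
proof -
  have "isCont (\<lambda>y. max 0 y) y" by (intro continuous_intros)
  then have "isCont (\<lambda>y. tanh (max 0 y / 2)) y" by (rule isCont_o2) (rule isCont_tanh_half)
  moreover have "1 + of_real (tanh (max 0 y / 2)) * c \<noteq> 0"
    using one_le_norm_one_plus[of c "tanh (max 0 y / 2)"] assms by auto
  ultimately show ?thesis
    unfolding progeny_pgf_def[abs_def] by (intro continuous_intros) auto
qed

lemma measurable_progeny_pgf: "0 \<le> Re c \<Longrightarrow> progeny_pgf c \<in> borel_measurable borel"
  by (intro borel_measurable_continuous_onI continuous_at_imp_continuous_on ballI isCont_progeny_pgf)

text \<open>
  In the variable \<open>u = tanh (y / 2)\<close>, \<open>h(u) = 2 Ln (1 + u) - 2 Ln (1 + u c)\<close> has the derivative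
  \<open>2 (1 - c) / ((1 + u) (1 + u c))\<close>, and \<open>u' = (1 - u\<^sup>2) / 2\<close>. Hence the derivative along \<open>y\<close> is
  \<open>q(u) = (1 - u) (1 - c) / (1 + u c)\<close>, which vanishes at \<open>u = 1\<close>, that is at \<open>y = \<infinity>\<close>, and
  \<open>q'(u) = - (1 - c\<^sup>2) / (1 + u c)\<^sup>2\<close>. The arguments of both logarithms have real part at least \<open>1\<close>, so
  the principal branch is differentiable along the path.
\<close>

lemma integral_progeny_pgf:
  fixes c :: complex
  assumes c: "0 \<le> Re c" and x: "0 \<le> x"
  shows "(\<integral>y. progeny_pgf c y \<partial>offspring_intensity x) =
      2 * Ln (1 + of_real (tanh (x / 2))) - 2 * Ln (1 + of_real (tanh (x / 2)) * c)"
proof -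
  define t where "t y = complex_of_real (tanh (y / 2))" for y
  define h where "h u = 2 * Ln (1 + u) - 2 * Ln (1 + u * c)" for u
  define q where "q u = (1 - u) * (1 - c) / (1 + u * c)" for u
  have t: "(t has_vector_derivative of_real (age_density y)) (at y)" for y
    unfolding t_def[abs_def] by (rule complex_tanh_half_vector_derivative)
  have age: "complex_of_real (age_density y) = (1 - t y ^ 2) / 2" for y
    by (simp add: age_density_def t_def)
  have pos: "1 \<le> Re (1 + t y)" "1 \<le> Re (1 + t y * c)" if "0 \<le> y" for y
    using Re_one_plus_ge_1[of 1 "tanh (y / 2)"] Re_one_plus_ge_1[of c "tanh (y / 2)"] that c
    by (simp_all add: t_def)
  have nz: "1 + t y \<noteq> 0" "1 + t y * c \<noteq> 0" if "0 \<le> y" for y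
    using pos[OF that] by (metis not_one_le_zero zero_complex.sel(1))+
  have dom: "1 + t y \<notin> \<real>\<^sub>\<le>\<^sub>0" "1 + t y * c \<notin> \<real>\<^sub>\<le>\<^sub>0" if "0 \<le> y" for y
    using pos[OF that] by (auto simp: complex_nonpos_Reals_iff)
  have "(\<integral>y. progeny_pgf c y \<partial>offspring_intensity x) = (h \<circ> t) x - (h \<circ> t) 0"
  proof (rule integral_offspring_intensity[OF x measurable_progeny_pgf[OF c] norm_progeny_pgf_le[OF c]
      isCont_progeny_pgf[OF c], where q="q \<circ> t"])
    fix y :: real assume y: "0 \<le> y"
    note nz = nz[OF y] and dom = dom[OF y]
    have "(h has_field_derivative (2 / (1 + t y) - 2 * c / (1 + t y * c))) (at (t y))"
      unfolding h_def using dom by (auto intro!: derivative_eq_intros simp: divide_inverse mult_ac)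
    from field_vector_diff_chain_at[OF t this]
    have "((h \<circ> t) has_vector_derivative
        of_real (age_density y) * (2 / (1 + t y) - 2 * c / (1 + t y * c))) (at y)" .
    also have "of_real (age_density y) * (2 / (1 + t y) - 2 * c / (1 + t y * c)) = (q \<circ> t) y"
    proof -
      have "2 / (1 + t y) - 2 * c / (1 + t y * c) = 2 * (1 - c) / ((1 + t y) * (1 + t y * c))"
        unfolding diff_frac_eq[OF nz] by (simp add: algebra_simps)
      also have "(1 - t y ^ 2) / 2 * \<dots> =
          ((1 + t y) * ((1 - t y) * (1 - c))) / ((1 + t y) * (1 + t y * c))"
      proof -
        have "a * b / 2 * (2 * e / d) = (a * (b * e)) / d" for a b d e :: complex by simp
        moreover have "1 - t y ^ 2 = (1 + t y) * (1 - t y)"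
          by (simp add: algebra_simps power2_eq_square)
        ultimately show ?thesis by metis
      qed
      also have "\<dots> = (q \<circ> t) y" using nz by (simp add: q_def)
      finally show ?thesis unfolding age .
    qed
    finally show "((h \<circ> t) has_vector_derivative (q \<circ> t) y) (at y)" .
    have "(q has_field_derivative - ((1 - c\<^sup>2) / (1 + t y * c)\<^sup>2)) (at (t y))"
      unfolding q_def using nz
      by (auto intro!: derivative_eq_intros simp: divide_simps power2_eq_square algebra_simps)
    from field_vector_diff_chain_at[OF t this]
    show "((q \<circ> t) has_vector_derivative - (age_density y *\<^sub>R progeny_pgf c y)) (at y)"
    proof -
      have "progeny_pgf c y = (1 - c\<^sup>2) / (1 + t y * c)\<^sup>2"
        using y by (simp add: progeny_pgf_def t_def)
      moreover assume "((q \<circ> t) has_vector_derivative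
          of_real (age_density y) * - ((1 - c\<^sup>2) / (1 + t y * c)\<^sup>2)) (at y)"
      ultimately show ?thesis by (simp add: scaleR_conv_of_real)
    qed
  next
    have "(t \<longlongrightarrow> of_real 1) at_top" unfolding t_def by (intro tendsto_of_real tanh_half_at_top)
    moreover have "1 + 1 * c \<noteq> 0" using one_le_norm_one_plus[OF c, of 1] by auto
    then have "isCont q (of_real 1)" unfolding q_def by (intro continuous_intros) auto
    ultimately have "((\<lambda>y. q (t y)) \<longlongrightarrow> q (of_real 1)) at_top"
      by (rule isCont_tendsto_compose[rotated])
    then show "((q \<circ> t) \<longlongrightarrow> 0) at_top" by (simp add: q_def o_def)
  qed
  then show ?thesis by (simp add: h_def t_def)
qed

text \<open>
  The exponent is \<open>2 (s - 1) Ln (1 + t) - 2 s Ln (1 + t c)\<close> with \<open>t = tanh (x / 2)\<close>, and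
  \<open>1 + t = 2 / (1 + e\<^sup>-\<^sup>x)\<close>.
\<close>

lemma offspring_poisson_functional_progeny:
  fixes c s :: complex
  assumes c: "0 \<le> Re c" and x: "0 \<le> x"
  shows "offspring.poisson_functional (\<lambda>y. s * progeny_pgf c y) x =
      of_real (2 / (1 + exp (- x))) powr (2 * (s - 1)) /
      (1 + of_real (tanh (x / 2)) * c) powr (2 * s)"
proof -
  let ?t = "tanh (x / 2)"
  have int: "integrable (offspring_intensity x) (progeny_pgf c)"
    by (rule offspring.integrable_kernel[OF measurable_progeny_pgf[OF c] norm_progeny_pgf_le[OF c]])
  interpret finite_measure "offspring_intensity x" by (rule finite_measure_offspring_intensity)
  have pos: "0 < 1 + ?t" using tanh_half_nonneg[OF x] by linarith
  have t: "2 / (1 + exp (- x)) = 1 + ?t"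
    using add_pos_pos[OF zero_less_one exp_gt_zero[of "- x"]]
    by (simp add: tanh_real_altdef field_simps)
  have nz: "1 + complex_of_real ?t * c \<noteq> 0"
    using one_le_norm_one_plus[OF c, of ?t] x by auto
  have Ln: "complex_of_real (ln (1 + ?t)) = Ln (1 + of_real ?t)"
    using Ln_of_real[OF pos] by simp
  have "(\<integral>y. (s * progeny_pgf c y - 1) \<partial>offspring_intensity x) =
      s * (\<integral>y. progeny_pgf c y \<partial>offspring_intensity x) - of_real (measure (offspring_intensity x) UNIV)"
    using int by (simp add: space_offspring_intensity scaleR_conv_of_real)
  also have "\<dots> = 2 * (s - 1) * Ln (1 + of_real ?t) - 2 * s * Ln (1 + of_real ?t * c)"
    unfolding integral_progeny_pgf[OF c x] offspring_intensity_total[OF x]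
    by (simp add: Ln algebra_simps)
  finally have I: "(\<integral>y. (s * progeny_pgf c y - 1) \<partial>offspring_intensity x) =
      2 * (s - 1) * Ln (1 + of_real ?t) - 2 * s * Ln (1 + of_real ?t * c)" .
  have nz': "1 + complex_of_real ?t \<noteq> 0"
    using one_le_norm_one_plus[of 1 ?t] x by auto
  show ?thesis
    unfolding offspring.poisson_functional_def t I exp_diff
    using nz nz' by (simp add: powr_def)
qed

section \<open>Convergence of the iterates\<close>

text \<open>
  The exponential function has a derivative of modulus at most \<open>1\<close> on the convex left half plane.
\<close>

lemma norm_exp_diff_le:
  fixes a b :: complex
  assumes "Re a \<le> 0" "Re b \<le> 0"
  shows "norm (exp a - exp b) \<le> norm (a - b)"
proof -
  have "norm (exp a - exp b) \<le> 1 * norm (a - b)"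
    by (rule field_differentiable_bound[OF convex_halfspace_Re_le, of 0 exp exp])
      (use assms in \<open>auto intro!: derivative_eq_intros\<close>)
  then show ?thesis by simp
qed

lemma norm_poisson_functional_diff_le:
  assumes x: "0 \<le> x"
    and f: "f \<in> borel_measurable borel" "\<And>y. norm (f y) \<le> 1"
    and g: "g \<in> borel_measurable borel" "\<And>y. norm (g y) \<le> 1"
    and w: "integrable (offspring_intensity x) w" "\<And>y. 0 \<le> y \<Longrightarrow> norm (f y - g y) \<le> w y"
  shows "norm (offspring.poisson_functional f x - offspring.poisson_functional g x) \<le>
      (\<integral>y. w y \<partial>offspring_intensity x)"
proof -
  interpret finite_measure "offspring_intensity x" by (rule finite_measure_offspring_intensity)
  have f1: "integrable (offspring_intensity x) (\<lambda>y. f y - 1)"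
    using offspring.integrable_kernel[OF f] by simp
  have g1: "integrable (offspring_intensity x) (\<lambda>y. g y - 1)"
    using offspring.integrable_kernel[OF g] by simp
  have re: "Re (\<integral>y. (f y - 1) \<partial>offspring_intensity x) \<le> 0"
    if "f \<in> borel_measurable borel" "\<And>y. norm (f y) \<le> 1" for f
    using offspring.norm_poisson_functional_le_1[OF that, of x]
    by (simp add: offspring.poisson_functional_def)
  have "norm (offspring.poisson_functional f x - offspring.poisson_functional g x) \<le>
      norm ((\<integral>y. (f y - 1) \<partial>offspring_intensity x) - (\<integral>y. (g y - 1) \<partial>offspring_intensity x))"
    unfolding offspring.poisson_functional_def by (intro norm_exp_diff_le re f g)
  also have "\<dots> = norm (\<integral>y. (f y - g y) \<partial>offspring_intensity x)"
    using Bochner_Integration.integral_diff[OF f1 g1] by simp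
  also have "\<dots> \<le> (\<integral>y. norm (f y - g y) \<partial>offspring_intensity x)" by (rule integral_norm_bound)
  also have "\<dots> \<le> (\<integral>y. w y \<partial>offspring_intensity x)"
    using AE_offspring_intensity_nonneg[of x] w
    by (intro integral_mono_AE integrable_norm Bochner_Integration.integrable_diff
        offspring.integrable_kernel[OF f] offspring.integrable_kernel[OF g]) (auto elim!: eventually_mono)
  finally show ?thesis .
qed

lemma progeny_pgf_fixed_point:
  assumes c: "0 \<le> Re c" and x: "0 \<le> x"
  shows "progeny_pgf c x = (1 - c\<^sup>2) * offspring.poisson_functional (progeny_pgf c) x"
proof -
  have nz: "1 + complex_of_real (tanh (x / 2)) * c \<noteq> 0"
    using one_le_norm_one_plus[OF c, of "tanh (x / 2)"] x by auto
  have "2 / (1 + exp (- x)) \<noteq> 0"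
    using add_pos_pos[OF zero_less_one exp_gt_zero[of "- x"]] by simp
  then have p0: "complex_of_real (2 / (1 + exp (- x))) powr (2 * (1 - 1)) = 1"
    unfolding powr_def of_real_eq_0_iff by simp
  have p2: "u powr (2 * 1) = u\<^sup>2" if "u \<noteq> 0" for u :: complex
    using powr_nat[of u 2] that by simp
  have "offspring.poisson_functional (progeny_pgf c) x = 1 / (1 + of_real (tanh (x / 2)) * c)\<^sup>2"
    using offspring_poisson_functional_progeny[OF c x, of 1] unfolding p0 p2[OF nz] by simp
  then show ?thesis using x by (simp add: progeny_pgf_def)
qed

text \<open>
  The distance of the \<open>k\<close>-th iterate to the closed form is at most \<open>2 |z| ^ k tanh (x / 2)\<close> for
  \<open>k \<ge> 1\<close>; the eigenfunction property carries this bound from \<open>k\<close> to \<open>k + 1\<close>. The induction starts at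
  \<open>k = 1\<close>, since the initial function \<open>0\<close> does not match the value \<open>z\<close> of the closed form at
  \<open>x = 0\<close>, where \<open>tanh\<close> vanishes.
\<close>

lemma height_pgf_tendsto_progeny_pgf:
  assumes c: "0 \<le> Re c" and c1: "norm (1 - c\<^sup>2) < 1" and x: "0 \<le> x"
  shows "(\<lambda>k. offspring.height_pgf (1 - c\<^sup>2) k x) \<longlonglongrightarrow> progeny_pgf c x"
proof -
  let ?z = "1 - c\<^sup>2" and ?F = "progeny_pgf c"
  let ?f = "offspring.height_pgf ?z"
  have z: "norm ?z \<le> 1" using c1 by simp
  have F: "?F \<in> borel_measurable borel" "norm (?F y) \<le> 1" for y
    using measurable_progeny_pgf[OF c] norm_progeny_pgf_le[OF c, of y] z by auto
  note f = offspring.measurable_height_pgf[OF z] offspring.norm_height_pgf_le_1[OF z]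
  have step: "norm (?f (Suc k) x - ?F x) \<le> norm ?z * (\<integral>y. w y \<partial>offspring_intensity x)"
    if "0 \<le> x" "integrable (offspring_intensity x) w" "\<And>y. 0 \<le> y \<Longrightarrow> norm (?f k y - ?F y) \<le> w y" for k w x
  proof -
    have "?f (Suc k) x - ?F x = ?z * (offspring.poisson_functional (?f k) x - offspring.poisson_functional ?F x)"
      by (simp add: progeny_pgf_fixed_point[OF c that(1)] right_diff_distrib)
    then show ?thesis
      using norm_poisson_functional_diff_le[OF that(1) f F that(2,3)]
      by (simp add: norm_mult mult_left_mono)
  qed
  \<comment> \<open>The base case uses that the total mass \<open>2 ln (1 + tanh (x / 2))\<close> is at most \<open>2 tanh (x / 2)\<close>.\<close>
  have bound: "norm (?f (Suc k) x - ?F x) \<le> 2 * norm ?z ^ Suc k * tanh (x / 2)" if "0 \<le> x" for k x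
    using that
  proof (induction k arbitrary: x)
    case 0
    interpret finite_measure "offspring_intensity x" by (rule finite_measure_offspring_intensity)
    have "norm (?f (Suc 0) x - ?F x) \<le> norm ?z * (\<integral>y. 1 \<partial>offspring_intensity x)"
      using F by (intro step 0) auto
    also have "\<dots> \<le> norm ?z * (2 * tanh (x / 2))"
      using offspring_intensity_total_le[OF 0] by (intro mult_left_mono) (simp_all add: space_offspring_intensity)
    finally show ?case by simp
  next
    case (Suc k)
    interpret finite_measure "offspring_intensity x" by (rule finite_measure_offspring_intensity)
    have int: "integrable (offspring_intensity x) (\<lambda>y. tanh (y / 2))"
    proof (rule integrable_const_bound[where B=1])
      show "AE y in offspring_intensity x. norm (tanh (y / 2)) \<le> 1"
        using tanh_real_bounds by (intro AE_I2) (auto simp: abs_le_iff less_imp_le minus_le_iff)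
      show "(\<lambda>y. tanh (y / 2)) \<in> borel_measurable (offspring_intensity x)"
        using measurable_tanh_half by (simp add: offspring_intensity_eq)
    qed
    have "norm (?f (Suc (Suc k)) x - ?F x) \<le>
        norm ?z * (\<integral>y. 2 * norm ?z ^ Suc k * tanh (y / 2) \<partial>offspring_intensity x)"
      using int by (intro step Suc integrable_mult_right) auto
    also have "\<dots> = 2 * norm ?z ^ Suc (Suc k) * tanh (x / 2)"
      using offspring_intensity_tanh[OF Suc.prems] by simp
    finally show ?case .
  qed
  have "(\<lambda>k. 2 * norm ?z ^ Suc k * tanh (x / 2)) \<longlonglongrightarrow> 2 * 0 * tanh (x / 2)"
    using c1 by (intro tendsto_intros LIMSEQ_Suc LIMSEQ_power_zero) auto
  then have "(\<lambda>k. 2 * norm ?z ^ Suc k * tanh (x / 2)) \<longlonglongrightarrow> 0" by simp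
  then have "(\<lambda>k. ?f (Suc k) x - ?F x) \<longlonglongrightarrow> 0"
    by (rule Lim_null_comparison[rotated]) (intro always_eventually allI bound x)
  then have "(\<lambda>k. ?f (Suc k) x) \<longlonglongrightarrow> ?F x" by (rule LIM_zero_cancel)
  then show ?thesis by (rule LIMSEQ_imp_Suc)
qed

section \<open>The conditional generating function\<close>

lemma complex_cond_exp_charact:
  fixes f g :: "'w \<Rightarrow> complex"
  assumes M: "finite_measure M" and sub: "subalgebra M F"
    and eq: "\<And>A. A \<in> sets F \<Longrightarrow>
      (\<integral>\<omega>. indicator A \<omega> *\<^sub>R f \<omega> \<partial>M) = (\<integral>\<omega>. indicator A \<omega> *\<^sub>R g \<omega> \<partial>M)"
    and f: "integrable M f" and g: "integrable M g" "g \<in> borel_measurable F"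
  shows "AE \<omega> in M. complex_cond_exp M F f \<omega> = g \<omega>"
proof -
  interpret finite_measure M by (rule M)
  interpret S: finite_measure_subalgebra M F
    by unfold_locales (rule sub)
  have int: "integrable M (\<lambda>\<omega>. indicator A \<omega> *\<^sub>R h \<omega>)"
    if "A \<in> sets F" "integrable M h" for A and h :: "'w \<Rightarrow> complex"
    using that sub by (intro integrable_mult_indicator) (auto simp: subalgebra_def)
  have "AE \<omega> in M. real_cond_exp M F (\<lambda>\<omega>. Re (f \<omega>)) \<omega> = Re (g \<omega>)"
  proof (rule S.real_cond_exp_charact)
    fix A assume A: "A \<in> sets F"
    show "(LINT \<omega>:A|M. Re (f \<omega>)) = (LINT \<omega>:A|M. Re (g \<omega>))"
      using arg_cong[OF eq[OF A], of Re]
      by (simp add: set_lebesgue_integral_def integral_Re[OF int[OF A f], symmetric]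
          integral_Re[OF int[OF A g(1)], symmetric])
  qed (use f g in \<open>auto intro: measurable_compose[OF _ borel_measurable_Re]\<close>)
  moreover have "AE \<omega> in M. real_cond_exp M F (\<lambda>\<omega>. Im (f \<omega>)) \<omega> = Im (g \<omega>)"
  proof (rule S.real_cond_exp_charact)
    fix A assume A: "A \<in> sets F"
    show "(LINT \<omega>:A|M. Im (f \<omega>)) = (LINT \<omega>:A|M. Im (g \<omega>))"
      using arg_cong[OF eq[OF A], of Im]
      by (simp add: set_lebesgue_integral_def integral_Im[OF int[OF A f], symmetric]
          integral_Im[OF int[OF A g(1)], symmetric])
  qed (use f g in \<open>auto intro: measurable_compose[OF _ borel_measurable_Im]\<close>)
  ultimately show ?thesis
    by eventually_elim (simp add: complex_cond_exp_def)
qed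

theorem lemma24:
  fixes z s :: complex
    and M :: "'w measure" and H :: "'w \<Rightarrow> aged_tree"
    and N :: "'v measure" and T :: "'v \<Rightarrow> aged_tree"
    and G :: "real \<Rightarrow> complex"
  assumes z: "norm z < 1"
    and G: "\<And>x. G x =
      z / (1 + of_real (tanh (x / 2)) * csqrt (1 - z)) powr (2 * s)
        * of_real (2 / (1 + exp (- x))) powr (2 * (s - 1))"
  shows
    "(multitype_GW_tree M age_law offspring_intensity H \<longrightarrow>
        integrable M (\<lambda>\<omega>. power_size z (H \<omega>) * s ^ root_degree (H \<omega>)) \<and>
        (AE \<omega> in M.
           complex_cond_exp M (vimage_algebra (space M) (\<lambda>\<omega>. root_age (H \<omega>)) borel)
             (\<lambda>\<omega>. power_size z (H \<omega>) * s ^ root_degree (H \<omega>)) \<omega>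
           = G (root_age (H \<omega>)))) \<and>
     (\<forall>x\<ge>0. multitype_GW_tree N (return borel x) offspring_intensity T \<longrightarrow>
        integrable N (\<lambda>\<omega>. power_size z (T \<omega>) * s ^ root_degree (T \<omega>)) \<and>
        (\<integral>\<omega>. power_size z (T \<omega>) * s ^ root_degree (T \<omega>) \<partial>N) = G x)"
proof (intro conjI impI allI)
  define c where "c = csqrt (1 - z)"
  have c: "0 \<le> Re c" using csqrt_principal[of "1 - z"] by (auto simp: c_def)
  have zc: "z = 1 - c\<^sup>2" by (simp add: c_def)
  \<comment> \<open>The candidate for the conditional expectation: bounded and measurable on the
    whole real line, and equal to \<open>G\<close> at nonnegative ages.\<close>
  define K where "K x = z * offspring.poisson_functional (\<lambda>y. s * progeny_pgf c y) x" for x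
  have K_G: "K x = G x" if "0 \<le> x" for x
    unfolding K_def G offspring_poisson_functional_progeny[OF c that] by (simp add: c_def)
  have F: "progeny_pgf c \<in> borel_measurable borel" "norm (progeny_pgf c y) \<le> 1" for y
    using measurable_progeny_pgf[OF c] norm_progeny_pgf_le[OF c, of y] z by (auto simp: zc)
  have K_meas: "K \<in> borel_measurable borel"
    unfolding K_def using F
    by (intro borel_measurable_times borel_measurable_const
        offspring.measurable_poisson_functional[where R="norm s"]) (auto simp: norm_mult mult_left_le)
  have K_le: "norm (K x) \<le> exp ((norm s + 1) * 2)" for x
  proof -
    have "norm (offspring.poisson_functional (\<lambda>y. s * progeny_pgf c y) x) \<le> exp ((norm s + 1) * 2)"
      using F by (intro offspring.norm_poisson_functional_le) (auto simp: norm_mult mult_left_le)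
    then show ?thesis unfolding K_def norm_mult using z
      by (meson less_imp_le mult_left_le_one_le norm_ge_zero order_trans)
  qed
  have lim: "AE y in offspring_intensity x. (\<lambda>k. offspring.height_pgf z k y) \<longlonglongrightarrow> progeny_pgf c y" for x
    using AE_offspring_intensity_nonneg[of x] height_pgf_tendsto_progeny_pgf[OF c] z
    by (auto elim!: eventually_mono simp: zc)
  have z1: "norm z \<le> 1" using z by simp

  {
    assume "multitype_GW_tree M age_law offspring_intensity H"
    then interpret GW_tree offspring_intensity 2 M age_law H
      by unfold_locales
    let ?X = "\<lambda>\<omega>. power_size z (H \<omega>) * s ^ root_degree (H \<omega>)"
    let ?S = "vimage_algebra (space M) (\<lambda>\<omega>. root_age (H \<omega>)) borel"
    note gf = total_progeny_generating_function[OF z1 F lim]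
    show int: "integrable M ?X"
      by (rule gf(1)[of "\<lambda>_. 1"]) auto
    have sub0: "subalgebra (past 0) ?S"
      unfolding subalgebra_def using measurable_root_age
      by (auto simp: sets_vimage_algebra2 dest: measurable_sets)
    then have sub: "subalgebra M ?S"
      using subalgebra_past[of 0] by (auto simp: subalgebra_def)
    have KS: "(\<lambda>\<omega>. K (root_age (H \<omega>))) \<in> borel_measurable ?S"
      by (rule measurable_compose[OF measurable_vimage_algebra1 K_meas]) simp
    have intK: "integrable M (\<lambda>\<omega>. K (root_age (H \<omega>)))"
      using measurable_from_subalg[OF sub KS] K_le by (intro integrable_const_bound) auto
    have "AE \<omega> in M. complex_cond_exp M ?S ?X \<omega> = K (root_age (H \<omega>))"
    proof (rule complex_cond_exp_charact[OF finite_measure_axioms sub _ int intK KS])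
      fix A assume "A \<in> sets ?S"
      then have "A \<in> sets (past 0)" using sub0 by (auto simp: subalgebra_def)
      then show "(\<integral>\<omega>. indicator A \<omega> *\<^sub>R ?X \<omega> \<partial>M) = (\<integral>\<omega>. indicator A \<omega> *\<^sub>R K (root_age (H \<omega>)) \<partial>M)"
        using gf(2)[of "\<lambda>\<omega>. of_real (indicator A \<omega>)" s]
        by (simp add: K_def scaleR_conv_of_real indicator_def)
    qed
    then show "AE \<omega> in M. complex_cond_exp M ?S ?X \<omega> = G (root_age (H \<omega>))"
      using AE_space by eventually_elim (simp add: K_G root_age_nonneg)
  }
  {
    fix x :: real assume x: "0 \<le> x" and "multitype_GW_tree N (return borel x) offspring_intensity T"
    then interpret GW_tree offspring_intensity 2 N "return borel x" T
      by unfold_locales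
    note gf = total_progeny_generating_function[OF z1 F lim]
    show "integrable N (\<lambda>\<omega>. power_size z (T \<omega>) * s ^ root_degree (T \<omega>))"
      by (rule gf(1)[of "\<lambda>_. 1"]) auto
    have "(\<integral>\<omega>. power_size z (T \<omega>) * s ^ root_degree (T \<omega>) \<partial>N) = (\<integral>\<omega>. K (root_age (T \<omega>)) \<partial>N)"
      using gf(2)[of "\<lambda>_. 1" s] by (simp add: K_def)
    also have "\<dots> = (\<integral>a. K a \<partial>distr N borel (\<lambda>\<omega>. root_age (T \<omega>)))"
      by (rule integral_distr[symmetric]) (use measurable_past[OF measurable_root_age] K_meas in auto)
    also have "distr N borel (\<lambda>\<omega>. root_age (T \<omega>)) = return borel x"
      using GW by (simp add: multitype_GW_tree_def)
    also have "(\<integral>a. K a \<partial>return borel x) = K x"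
      by (rule integral_return) (use K_meas in auto)
    also have "\<dots> = G x" by (rule K_G[OF x])
    finally show "(\<integral>\<omega>. power_size z (T \<omega>) * s ^ root_degree (T \<omega>) \<partial>N) = G x" .
  }
qed

end
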